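(* Let $q\in\overline{\mathcal U}$. Then: (i) $\overline{\mathcal U_q}=\mathcal V_q$; (ii) $|\mathcal V_q\setminus\mathcal U_q|=\aleph_0$ and $\mathcal V_q\setminus\mathcal U_q$ is dense in $\mathcal V_q$; (iii) if $q\in\mathcal U$, then each $x\in\mathcal V_q\setminus\mathcal U_q$ has exactly $2$ expansions in base $q$; (iv) if $q\in\overline{\mathcal U}\setminus\mathcal U$, then each $x\in\mathcal V_q\setminus\mathcal U_q$ has exactly $\aleph_0$ expansions in base $q$.
   Context: Fix a positive integer $M$ and the alphabet $A=\{0,1,\dots,M\}$. Sequences are elements of $A^{\mathbb N}$ ($\mathbb N=\{1,2,\dots\}$). A sequence is called finite if it has a last nonzero digit and infinite otherwise (so $0^\infty$ is infinite); it is co-infinite if the sequence $(M-c_i)$ is infinite, and doubly infinite if it is both infinite and co-infinite. For $q\in(1,M+1]$, an expansion of a real number $x$ in base $q$ is a sequence $(c_i)\in A^{\mathbb N}$ with $\sum_{i\ge1}c_iq^{-i}=x$; the set of numbers having an expansion is $J_q=[0,M/(q-1)]$. $\mathcal U$ denotes the set of $q>1$ such that $1$ has a unique expansion in base $q$, and $\overline{\mathcal U}$ its closure; all these $q$ lie in $(1,M+1]$. For $q\in(1,M+1]$, $\mathcal U_q$ is the set of $x\in J_q$ having a unique expansion in base $q$, and $\overline{\mathcal U_q}$ its closure. For $q\in(1,M+1)$, $\mathcal V_q$ is the set of $x\in J_q$ having a unique doubly infinite expansion in base $q$; for $q=M+1$, $\mathcal V_q:=J_q=[0,1]$. *)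

theory Defs
  imports "HOL-Analysis.Analysis" "HOL-Library.Equipollence"
begin

text \<open>
  Sequences are indexed from 0 here: \<open>c i\<close> is the digit multiplying \<open>q\<^sup>-\<^sup>(\<^sup>i\<^sup>+\<^sup>1\<^sup>)\<close>.
\<close>

definition digit_seqs :: "nat \<Rightarrow> (nat \<Rightarrow> nat) set" where
  "digit_seqs M = {c. \<forall>i. c i \<in> {0..M}}"

definition finite_seq :: "(nat \<Rightarrow> nat) \<Rightarrow> bool" where
  "finite_seq c \<longleftrightarrow> (\<exists>n. c n \<noteq> 0 \<and> (\<forall>k>n. c k = 0))"

text \<open>The zero sequence has no last nonzero digit, so it counts as infinite.\<close>

definition infinite_seq :: "(nat \<Rightarrow> nat) \<Rightarrow> bool" where
  "infinite_seq c \<longleftrightarrow> \<not> finite_seq c"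

definition coinfinite_seq :: "nat \<Rightarrow> (nat \<Rightarrow> nat) \<Rightarrow> bool" where
  "coinfinite_seq M c \<longleftrightarrow> infinite_seq (\<lambda>i. M - c i)"

definition doubly_infinite_seq :: "nat \<Rightarrow> (nat \<Rightarrow> nat) \<Rightarrow> bool" where
  "doubly_infinite_seq M c \<longleftrightarrow> infinite_seq c \<and> coinfinite_seq M c"

definition expansions :: "nat \<Rightarrow> real \<Rightarrow> real \<Rightarrow> (nat \<Rightarrow> nat) set" where
  "expansions M q x = {c \<in> digit_seqs M. (\<lambda>i. real (c i) / q ^ Suc i) sums x}"

definition J_set :: "nat \<Rightarrow> real \<Rightarrow> real set" where
  "J_set M q = {0..real M / (q - 1)}"

text \<open>
  No upper bound on \<open>q\<close> is imposed: for \<open>q > M + 1\<close> the number 1 has no expansion at all.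
\<close>

definition univoque_bases :: "nat \<Rightarrow> real set" where
  "univoque_bases M = {q. q > 1 \<and> (\<exists>!c. c \<in> expansions M q 1)}"

definition U_set :: "nat \<Rightarrow> real \<Rightarrow> real set" where
  "U_set M q = {x \<in> J_set M q. \<exists>!c. c \<in> expansions M q x}"

definition V_set :: "nat \<Rightarrow> real \<Rightarrow> real set" where
  "V_set M q =
    (if q = real M + 1 then J_set M q
     else {x \<in> J_set M q. \<exists>!c. c \<in> expansions M q x \<and> doubly_infinite_seq M c})"

end

theory Submission
  imports Defs
begin

text \<open>
  For \<open>q\<close> in the closure of the univoque bases, a limit \<open>\<alpha>\<close> of unique expansions of 1 is an expansion
  of 1 in base \<open>q\<close>, all its tails following a digit \<open>< M\<close> are lexicographically \<open>\<le> \<alpha>\<close>, and all its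
  reflected tails following a digit \<open>> 0\<close> are strictly \<open>< \<alpha>\<close>. These two properties suffice for
  everything else. The sets \<open>V\<^sub>q\<close> and \<open>U\<^sub>q\<close> consist of the values of the sequences all of whose tails
  (after digits \<open>< M\<close>) and reflected tails (after digits \<open>> 0\<close>) are \<open>\<le> \<alpha>\<close>, respectively \<open>< \<alpha>\<close>.
  So a point of \<open>V\<^sub>q\<close> outside \<open>U\<^sub>q\<close> is given, up to reflection, by a sequence ending in \<open>\<alpha>\<close>. Its other
  expansions arise by increasing the digit before an occurrence of the tail \<open>\<alpha>\<close> and continuing with
  zeros, so their number depends on whether \<open>\<alpha>\<close> is periodic, i.e. on whether \<open>q\<close> is univoque.
  Density of \<open>U\<^sub>q\<close> follows by replacing the tail \<open>\<alpha>\<close> by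
  \<open>\<alpha>\<^sub>0 \<dots> \<alpha>\<^sub>n\<close> alternating with its reflection, for suitable large \<open>n\<close>. Density of the complement
  follows by lowering a suitable digit of a sequence and continuing with \<open>\<alpha>\<close>.
\<close>

section \<open>Digit sequences and their lexicographic order\<close>

definition tail_seq :: "nat \<Rightarrow> (nat \<Rightarrow> nat) \<Rightarrow> nat \<Rightarrow> nat" where
  "tail_seq n c = (\<lambda>i. c (n + i))"

definition mirror :: "nat \<Rightarrow> (nat \<Rightarrow> nat) \<Rightarrow> nat \<Rightarrow> nat" where
  "mirror M c = (\<lambda>i. M - c i)"

definition append_seq :: "nat \<Rightarrow> (nat \<Rightarrow> nat) \<Rightarrow> (nat \<Rightarrow> nat) \<Rightarrow> nat \<Rightarrow> nat" where
  "append_seq n c e = (\<lambda>i. if i < n then c i else e (i - n))"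

definition lex_less :: "(nat \<Rightarrow> nat) \<Rightarrow> (nat \<Rightarrow> nat) \<Rightarrow> bool" (infix "\<sqsubset>" 50) where
  "c \<sqsubset> d \<longleftrightarrow> (\<exists>n. (\<forall>i<n. c i = d i) \<and> c n < d n)"

definition lex_le :: "(nat \<Rightarrow> nat) \<Rightarrow> (nat \<Rightarrow> nat) \<Rightarrow> bool" (infix "\<sqsubseteq>" 50) where
  "c \<sqsubseteq> d \<longleftrightarrow> c \<sqsubset> d \<or> c = d"

definition seq_value :: "real \<Rightarrow> (nat \<Rightarrow> nat) \<Rightarrow> real" where
  "seq_value q c = (\<Sum>i. real (c i) / q ^ Suc i)"

lemma digit_seqs_iff: "c \<in> digit_seqs M \<longleftrightarrow> (\<forall>i. c i \<le> M)"
  by (auto simp: digit_seqs_def)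

lemma tail_seq_in_digit_seqs: "c \<in> digit_seqs M \<Longrightarrow> tail_seq n c \<in> digit_seqs M"
  by (simp add: digit_seqs_iff tail_seq_def)

lemma mirror_in_digit_seqs [simp]: "mirror M c \<in> digit_seqs M"
  by (simp add: digit_seqs_iff mirror_def)

lemma append_seq_in_digit_seqs:
  "c \<in> digit_seqs M \<Longrightarrow> e \<in> digit_seqs M \<Longrightarrow> append_seq n c e \<in> digit_seqs M"
  by (simp add: digit_seqs_iff append_seq_def)

lemma mirror_mirror: "c \<in> digit_seqs M \<Longrightarrow> mirror M (mirror M c) = c"
  by (auto simp: digit_seqs_iff mirror_def)

lemma tail_seq_mirror: "tail_seq n (mirror M c) = mirror M (tail_seq n c)"
  by (simp add: tail_seq_def mirror_def)

lemma tail_seq_tail_seq: "tail_seq n (tail_seq m c) = tail_seq (m + n) c"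
  by (simp add: tail_seq_def add.assoc)

lemma tail_append_seq: "tail_seq n (append_seq n c e) = e"
  by (simp add: tail_seq_def append_seq_def)

lemma append_tail_seq: "append_seq n c (tail_seq n c) = c"
  by (auto simp: tail_seq_def append_seq_def)

lemma tail_append_seq_le:
  "k \<le> n \<Longrightarrow> tail_seq k (append_seq n c e) = append_seq (n - k) (tail_seq k c) e"
  by (auto simp: tail_seq_def append_seq_def fun_eq_iff less_diff_conv add.commute)

lemma append_seq_add: "append_seq n c e (n + i) = e i"
  by (simp add: append_seq_def)

lemma tail_append_seq_add: "tail_seq (Suc (n + i)) (append_seq n c e) = tail_seq (Suc i) e"
  by (simp add: tail_seq_def append_seq_def)

lemma mirror_append_seq: "mirror M (append_seq n c e) = append_seq n (mirror M c) (mirror M e)"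
  by (auto simp: mirror_def append_seq_def)

lemma first_difference:
  fixes c d :: "nat \<Rightarrow> nat"
  assumes "c \<noteq> d"
  obtains n where "\<forall>i<n. c i = d i" "c n \<noteq> d n"
proof -
  from assms have ex: "\<exists>n. c n \<noteq> d n" by auto
  show thesis
    using that[of "LEAST n. c n \<noteq> d n"] LeastI_ex[OF ex] not_less_Least by blast
qed

lemma lex_linear: "c \<sqsubset> d \<or> c = d \<or> d \<sqsubset> c"
proof (cases "c = d")
  case False
  then obtain n where "\<forall>i<n. c i = d i" "c n \<noteq> d n" by (rule first_difference)
  then show ?thesis unfolding lex_less_def by (metis linorder_neqE_nat)
qed simp

lemma lex_irrefl: "\<not> c \<sqsubset> c"
  by (auto simp: lex_less_def)

lemma lex_trans: "c \<sqsubset> d \<Longrightarrow> d \<sqsubset> e \<Longrightarrow> c \<sqsubset> e"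
proof -
  assume "c \<sqsubset> d" "d \<sqsubset> e"
  then obtain m n where m: "\<forall>i<m. c i = d i" "c m < d m" and n: "\<forall>i<n. d i = e i" "d n < e n"
    unfolding lex_less_def by blast
  show ?thesis
  proof (cases "m < n")
    case True
    then show ?thesis using m n unfolding lex_less_def by (intro exI[of _ m]) auto
  next
    case False
    then have "\<forall>i<n. c i = e i" "c n < e n"
      using m n by (auto, metis linorder_neqE_nat order.strict_trans)
    then show ?thesis unfolding lex_less_def by blast
  qed
qed

lemma lex_not_less: "\<not> c \<sqsubset> d \<longleftrightarrow> d \<sqsubseteq> c"
  using lex_linear lex_irrefl lex_trans unfolding lex_le_def by metis

lemma lex_not_le: "\<not> c \<sqsubseteq> d \<longleftrightarrow> d \<sqsubset> c"
  using lex_not_less by blast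

lemma lex_le_refl [simp]: "c \<sqsubseteq> c"
  by (simp add: lex_le_def)

lemma lex_less_imp_le: "c \<sqsubset> d \<Longrightarrow> c \<sqsubseteq> d"
  by (simp add: lex_le_def)

lemma lex_le_less_trans: "c \<sqsubseteq> d \<Longrightarrow> d \<sqsubset> e \<Longrightarrow> c \<sqsubset> e"
  using lex_trans unfolding lex_le_def by blast

lemma lex_less_le_trans: "c \<sqsubset> d \<Longrightarrow> d \<sqsubseteq> e \<Longrightarrow> c \<sqsubset> e"
  using lex_trans unfolding lex_le_def by blast

lemma lex_less_mirror:
  assumes "c \<in> digit_seqs M" "d \<in> digit_seqs M" "c \<sqsubset> d"
  shows "mirror M d \<sqsubset> mirror M c"
proof -
  obtain n where n: "\<forall>i<n. c i = d i" "c n < d n" using assms(3) lex_less_def by blast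
  have "d n \<le> M" using assms(2) by (simp add: digit_seqs_iff)
  then show ?thesis using n unfolding lex_less_def mirror_def
    by (intro exI[of _ n]) auto
qed

lemma lex_less_append_iff: "append_seq n c d \<sqsubset> append_seq n c e \<longleftrightarrow> d \<sqsubset> e"
proof
  assume "append_seq n c d \<sqsubset> append_seq n c e"
  then obtain k where k: "\<forall>i<k. append_seq n c d i = append_seq n c e i"
    "append_seq n c d k < append_seq n c e k"
    unfolding lex_less_def by blast
  have "n \<le> k" using k(2) by (auto simp: append_seq_def split: if_splits)
  moreover have "d i = e i" if "i < k - n" for i
    using k(1)[rule_format, of "i + n"] that by (simp add: append_seq_def)
  ultimately show "d \<sqsubset> e"
    using k(2) unfolding lex_less_def append_seq_def by (intro exI[of _ "k - n"]) auto
next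
  assume "d \<sqsubset> e"
  then obtain k where k: "\<forall>i<k. d i = e i" "d k < e k" unfolding lex_less_def by blast
  then show "append_seq n c d \<sqsubset> append_seq n c e"
    unfolding lex_less_def append_seq_def by (intro exI[of _ "n + k"]) auto
qed

text \<open>The first difference already decides the order, so the inequality persists under any
  change of later digits. This is openness of the strict order in the product topology.\<close>

lemma lex_less_open:
  assumes "c \<sqsubset> d"
  obtains N where "\<And>e f. (\<forall>i<N. e i = c i) \<Longrightarrow> (\<forall>i<N. f i = d i) \<Longrightarrow> e \<sqsubset> f"
proof -
  obtain n where "\<forall>i<n. c i = d i" "c n < d n" using assms lex_less_def by blast
  then have "e \<sqsubset> f" if "\<forall>i<Suc n. e i = c i" "\<forall>i<Suc n. f i = d i" for e f
    using that unfolding lex_less_def by (intro exI[of _ n]) auto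
  then show thesis using that by blast
qed

section \<open>Values of digit sequences\<close>

lemma geometric_digit_sums:
  assumes "q > 1"
  shows "(\<lambda>i. real M / q ^ Suc i) sums (real M / (q - 1))"
proof -
  have "(\<lambda>i. (1 / q) ^ i) sums (1 / (1 - 1 / q))"
    using assms by (intro geometric_sums) auto
  from sums_mult[OF this, of "real M / q"] show ?thesis
    using assms by (simp add: field_simps)
qed

lemma summable_digits:
  assumes "q > 1" "c \<in> digit_seqs M"
  shows "summable (\<lambda>i. real (c i) / q ^ Suc i)"
proof (rule summable_comparison_test)
  show "summable (\<lambda>i. real M / q ^ Suc i)"
    using geometric_digit_sums[OF assms(1)] sums_summable by blast
  show "\<exists>N. \<forall>n\<ge>N. norm (real (c n) / q ^ Suc n) \<le> real M / q ^ Suc n"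
    using assms by (auto intro!: divide_right_mono simp: digit_seqs_iff)
qed

lemma seq_value_sums:
  assumes "q > 1" "c \<in> digit_seqs M"
  shows "(\<lambda>i. real (c i) / q ^ Suc i) sums seq_value q c"
  using summable_digits[OF assms] unfolding seq_value_def by (rule summable_sums)

lemma expansions_iff:
  assumes "q > 1"
  shows "c \<in> expansions M q x \<longleftrightarrow> c \<in> digit_seqs M \<and> seq_value q c = x"
  using seq_value_sums[OF assms] sums_unique2 unfolding expansions_def by blast

lemma seq_value_nonneg:
  assumes "q > 1" "c \<in> digit_seqs M"
  shows "0 \<le> seq_value q c"
  unfolding seq_value_def using summable_digits[OF assms] assms
  by (intro suminf_nonneg) auto

lemma seq_value_pos:
  assumes "q > 1" "c \<in> digit_seqs M" "c i > 0"
  shows "0 < seq_value q c"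
  unfolding seq_value_def using summable_digits[OF assms(1,2)] assms
  by (intro suminf_pos2[of _ i]) auto

lemma seq_value_mirror:
  assumes "q > 1" "c \<in> digit_seqs M"
  shows "seq_value q (mirror M c) = real M / (q - 1) - seq_value q c"
proof -
  have "(\<lambda>i. real M / q ^ Suc i - real (c i) / q ^ Suc i) sums (real M / (q - 1) - seq_value q c)"
    by (rule sums_diff[OF geometric_digit_sums[OF assms(1)] seq_value_sums[OF assms]])
  moreover have "real M / q ^ Suc i - real (c i) / q ^ Suc i = real (mirror M c i) / q ^ Suc i" for i
    using assms(2) by (simp add: mirror_def digit_seqs_iff diff_divide_distrib)
  ultimately show ?thesis
    unfolding seq_value_def using sums_unique by force
qed

lemma seq_value_le:
  assumes "q > 1" "c \<in> digit_seqs M"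
  shows "seq_value q c \<le> real M / (q - 1)"
  using seq_value_mirror[OF assms] seq_value_nonneg[OF assms(1) mirror_in_digit_seqs[of M c]] by simp

lemma seq_value_in_J_set:
  "q > 1 \<Longrightarrow> c \<in> digit_seqs M \<Longrightarrow> seq_value q c \<in> J_set M q"
  using seq_value_nonneg[of q c M] seq_value_le[of q c M] by (simp add: J_set_def)

lemma seq_value_split:
  assumes "q > 1" "c \<in> digit_seqs M"
  shows "seq_value q c = (\<Sum>i<n. real (c i) / q ^ Suc i) + seq_value q (tail_seq n c) / q ^ n"
proof -
  have "seq_value q c = (\<Sum>i. real (c (i + n)) / q ^ Suc (i + n)) + (\<Sum>i<n. real (c i) / q ^ Suc i)"
    unfolding seq_value_def by (rule suminf_split_initial_segment[OF summable_digits[OF assms]])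
  also have "(\<Sum>i. real (c (i + n)) / q ^ Suc (i + n)) = (\<Sum>i. real (tail_seq n c i) / q ^ Suc i / q ^ n)"
    by (simp add: tail_seq_def power_add add.commute mult.assoc mult.left_commute)
  also have "\<dots> = seq_value q (tail_seq n c) / q ^ n"
    unfolding seq_value_def
    by (rule suminf_divide[OF summable_digits[OF assms(1) tail_seq_in_digit_seqs[OF assms(2)]]])
  finally show ?thesis by simp
qed

text \<open>Scaling by \<open>q ^ Suc k\<close> cancels the common prefix and leaves the digit gap
  at \<open>k\<close> against the two tails; the later comparisons of values rest on this
  identity.\<close>

lemma seq_value_diff:
  assumes "q > 1" "c \<in> digit_seqs M" "d \<in> digit_seqs M" "\<forall>i<k. c i = d i"
  shows "(seq_value q d - seq_value q c) * q ^ Suc k =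
    real (d k) - real (c k) + seq_value q (tail_seq (Suc k) d) - seq_value q (tail_seq (Suc k) c)"
proof -
  have "(\<Sum>i<k. real (c i) / q ^ Suc i) = (\<Sum>i<k. real (d i) / q ^ Suc i)"
    using assms(4) by (intro sum.cong) auto
  then show ?thesis
    using seq_value_split[OF assms(1,2), of "Suc k"] seq_value_split[OF assms(1,3), of "Suc k"] assms(1)
    by (simp add: field_simps)
qed

lemma seq_value_append:
  assumes "q > 1" "c \<in> digit_seqs M" "e \<in> digit_seqs M"
  shows "(seq_value q (append_seq n c e) - seq_value q c) * q ^ n
    = seq_value q e - seq_value q (tail_seq n c)"
proof -
  have "(\<Sum>i<n. real (append_seq n c e i) / q ^ Suc i) = (\<Sum>i<n. real (c i) / q ^ Suc i)"
    by (intro sum.cong) (auto simp: append_seq_def)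
  then show ?thesis
    using seq_value_split[OF assms(1,2), of n]
      seq_value_split[OF assms(1) append_seq_in_digit_seqs[OF assms(2,3)], of n n] assms(1)
    by (simp add: tail_append_seq field_simps)
qed

lemma seq_value_prefix:
  assumes "q > 1" "c \<in> digit_seqs M" "d \<in> digit_seqs M" "\<forall>i<n. c i = d i"
  shows "\<bar>seq_value q d - seq_value q c\<bar> \<le> real M / (q - 1) / q ^ n"
proof -
  have "d = append_seq n c (tail_seq n d)"
    using assms(4) by (auto simp: append_seq_def tail_seq_def)
  with seq_value_append[OF assms(1,2) tail_seq_in_digit_seqs[OF assms(3)], of n n]
  have "(seq_value q d - seq_value q c) * q ^ n = seq_value q (tail_seq n d) - seq_value q (tail_seq n c)"
    by metis
  moreover have "\<bar>seq_value q (tail_seq n d) - seq_value q (tail_seq n c)\<bar> \<le> real M / (q - 1)"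
    using seq_value_nonneg[OF assms(1) tail_seq_in_digit_seqs[OF assms(2)], of n]
      seq_value_nonneg[OF assms(1) tail_seq_in_digit_seqs[OF assms(3)], of n]
      seq_value_le[OF assms(1) tail_seq_in_digit_seqs[OF assms(2)], of n]
      seq_value_le[OF assms(1) tail_seq_in_digit_seqs[OF assms(3)], of n] by linarith
  ultimately have "\<bar>seq_value q d - seq_value q c\<bar> * q ^ n \<le> real M / (q - 1)"
    using assms(1) by (metis abs_mult abs_of_nonneg less_eq_real_def order_less_trans zero_le_power zero_less_one)
  then show ?thesis using assms(1) by (subst pos_le_divide_eq) auto
qed

text \<open>A long common prefix makes values close, so approximating the digits approximates the
  number. Density of sets of reals is thereby reduced to approximation of sequences.\<close>

lemma prefix_closure:
  assumes "q > 1" "c \<in> digit_seqs M"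
    and "\<And>N. \<exists>d \<in> digit_seqs M. (\<forall>i<N. d i = c i) \<and> seq_value q d \<in> S"
  shows "seq_value q c \<in> closure S"
  unfolding closure_approachable
proof (intro allI impI)
  fix e :: real assume "e > 0"
  have "(\<lambda>n. real M / (q - 1) / q ^ n) \<longlonglongrightarrow> 0"
    using assms(1) by (intro LIMSEQ_divide_realpow_zero)
  then have "\<forall>\<^sub>F n in sequentially. real M / (q - 1) / q ^ n < e"
    using \<open>e > 0\<close> by (rule order_tendstoD)
  then obtain n where n: "real M / (q - 1) / q ^ n < e"
    by (auto simp: eventually_sequentially)
  obtain d where "d \<in> digit_seqs M" "\<forall>i<n. d i = c i" "seq_value q d \<in> S"
    using assms(3) by blast
  then show "\<exists>y\<in>S. dist y (seq_value q c) < e"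
    using seq_value_prefix[OF assms(1,2), of d n] n by (intro bexI[of _ "seq_value q d"]) (auto simp: dist_real_def)
qed

section \<open>Limits of digit sequences\<close>

text \<open>Tychonoff: \<open>digit_seqs M\<close> is a product of finite discrete spaces, hence
  compact, and sequentially compact because the product topology is first countable here.
  Convergence of an integer coordinate means eventual equality.\<close>

lemma digit_seqs_convergent_subsequence:
  fixes f :: "nat \<Rightarrow> nat \<Rightarrow> nat"
  assumes "\<And>k. f k \<in> digit_seqs M"
  obtains c r where "c \<in> digit_seqs M" "strict_mono r"
    "\<And>i. \<forall>\<^sub>F k in sequentially. f (r k) i = c i"
proof -
  have "compactin (product_topology (\<lambda>i::nat. euclidean :: nat topology) UNIV) (PiE UNIV (\<lambda>i. {0..M}))"
    by (subst compactin_PiE) (simp add: finite_imp_compact)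
  moreover have "PiE UNIV (\<lambda>i::nat. {0..M}) = digit_seqs M"
    by (auto simp: PiE_def digit_seqs_def)
  ultimately have "compact (digit_seqs M)"
    by (simp add: euclidean_product_topology)
  then have "seq_compact (digit_seqs M)"
    by (rule compact_imp_seq_compact)
  then obtain c r where c: "c \<in> digit_seqs M" "strict_mono r" "(f \<circ> r) \<longlonglongrightarrow> c"
    using assms unfolding seq_compact_def by blast
  have "limitin (product_topology (\<lambda>i::nat. euclidean :: nat topology) UNIV) (f \<circ> r) c sequentially"
    using c(3) by (simp add: euclidean_product_topology)
  then have "(\<lambda>k. (f \<circ> r) k i) \<longlonglongrightarrow> c i" for i
    by (simp add: limitin_componentwise)
  then have "\<forall>\<^sub>F k in sequentially. f (r k) i = c i" for i
    by (simp add: tendsto_discrete)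
  then show thesis using that c by blast
qed

lemma eventually_prefix_eq:
  fixes f :: "nat \<Rightarrow> nat \<Rightarrow> nat"
  assumes "\<And>i. \<forall>\<^sub>F k in sequentially. f k i = c i"
  shows "\<forall>\<^sub>F k in sequentially. \<forall>i<N. f k i = c i"
proof -
  have "\<forall>\<^sub>F k in sequentially. \<forall>i\<in>{..<N}. f k i = c i"
    using assms by (intro eventually_ball_finite) auto
  then show ?thesis by (simp add: Ball_def)
qed

text \<open>A failure in the limit would be a strict inequality the other way, which by
  \<open>lex_less_open\<close> would already hold for late approximants.\<close>

lemma lex_le_limit:
  assumes "\<And>i. \<forall>\<^sub>F k in sequentially. f k i = c i"
    and "\<And>i. \<forall>\<^sub>F k in sequentially. g k i = d i"
    and "\<forall>\<^sub>F k in sequentially. f k \<sqsubseteq> g k"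
  shows "c \<sqsubseteq> d"
proof (rule ccontr)
  assume "\<not> c \<sqsubseteq> d"
  then have "d \<sqsubset> c" by (simp add: lex_not_le)
  then obtain N where N: "\<And>e f. (\<forall>i<N. e i = d i) \<Longrightarrow> (\<forall>i<N. f i = c i) \<Longrightarrow> e \<sqsubset> f"
    using lex_less_open by metis
  have "\<forall>\<^sub>F k in sequentially. (\<forall>i<N. f k i = c i) \<and> (\<forall>i<N. g k i = d i) \<and> f k \<sqsubseteq> g k"
    by (intro eventually_conj eventually_prefix_eq assms)
  then obtain k where "\<forall>i<N. f k i = c i" "\<forall>i<N. g k i = d i" "f k \<sqsubseteq> g k"
    by (auto simp: eventually_sequentially)
  then show False using N[of "g k" "f k"] lex_not_le by blast
qed

text \<open>Base and digits vary together, so the limit is taken inside the series by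
  domination.\<close>

lemma seq_value_tendsto:
  assumes p: "p \<longlonglongrightarrow> q" "q > 1" and f: "\<And>k. f k \<in> digit_seqs M"
    and c: "\<And>i. \<forall>\<^sub>F k in sequentially. f k i = c i"
  shows "(\<lambda>k. seq_value (p k) (f k)) \<longlonglongrightarrow> seq_value q c"
  unfolding seq_value_def
proof (rule tannerys_theorem[THEN conjunct2, THEN conjunct2])
  \<comment> \<open>Any number strictly between 1 and \<open>q\<close> serves: eventually
    \<open>r < p k\<close>, and then \<open>M / r ^ Suc i\<close> is a summable majorant independent
    of \<open>k\<close>.\<close>
  define r where "r = (1 + q) / 2"
  have r: "1 < r" "r < q" using p(2) by (auto simp: r_def)
  show "(\<lambda>k. real (f k i) / p k ^ Suc i) \<longlonglongrightarrow> real (c i) / q ^ Suc i" for i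
  proof -
    have "(\<lambda>k. real (c i) / p k ^ Suc i) \<longlonglongrightarrow> real (c i) / q ^ Suc i"
      using p by (intro tendsto_intros) auto
    moreover have "\<forall>\<^sub>F k in sequentially. real (c i) / p k ^ Suc i = real (f k i) / p k ^ Suc i"
      using c[of i] by eventually_elim simp
    ultimately show ?thesis by (rule Lim_transform_eventually)
  qed
  show "\<forall>\<^sub>F (i, k) in at_top \<times>\<^sub>F sequentially. norm (real (f k i) / p k ^ Suc i) \<le> real M / r ^ Suc i"
  proof -
    have "\<forall>\<^sub>F k in sequentially. r < p k"
      using p(1) r(2) by (rule order_tendstoD)
    then have "\<forall>\<^sub>F z in at_top \<times>\<^sub>F sequentially. r < p (snd z)"
      by (rule eventually_compose_filterlim[OF _ filterlim_snd])
    then show ?thesis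
    proof (eventually_elim, clarsimp)
      fix i k assume "r < p k"
      then show "real (f k i) / \<bar>p k * p k ^ i\<bar> \<le> real M / (r * r ^ i)"
        using r f[of k] by (intro frac_le) (auto simp: digit_seqs_iff intro!: mult_mono power_mono)
    qed
  qed
  show "summable (\<lambda>i. real M / r ^ Suc i)"
    using geometric_digit_sums[OF r(1)] sums_summable by blast
qed auto

section \<open>Existence and uniqueness of expansions\<close>

text \<open>The recursion telescopes: the partial sums are \<open>r k\<close> up to the error
  \<open>r (k + n) / q ^ n\<close>, which vanishes because the remainders are bounded.\<close>

lemma seq_value_eq_remainder:
  assumes "q > 1" "d \<in> digit_seqs M"
    and step: "\<And>n. q * r n = real (d n) + r (Suc n)" and bd: "\<And>n. \<bar>r n\<bar> \<le> B"
  shows "seq_value q (tail_seq k d) = r k"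
proof -
  have part: "(\<Sum>i<n. real (tail_seq k d i) / q ^ Suc i) = r k - r (k + n) / q ^ n" for n
  proof (induction n)
    case (Suc n)
    have "r (k + n) / q ^ n = (q * r (k + n)) / q ^ Suc n"
      using assms(1) by simp
    also have "\<dots> = real (d (k + n)) / q ^ Suc n + r (Suc (k + n)) / q ^ Suc n"
      using step[of "k + n"] by (simp add: add_divide_distrib)
    finally show ?case using Suc by (simp add: tail_seq_def)
  qed simp
  have "(\<lambda>n. B / q ^ n) \<longlonglongrightarrow> 0" using assms(1) by (rule LIMSEQ_divide_realpow_zero)
  then have "(\<lambda>n. r (k + n) / q ^ n) \<longlonglongrightarrow> 0"
  proof (rule Lim_null_comparison[rotated])
    show "\<forall>\<^sub>F n in sequentially. norm (r (k + n) / q ^ n) \<le> B / q ^ n"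
      using bd assms(1) by (intro always_eventually allI) (auto intro!: divide_right_mono)
  qed
  then have "(\<lambda>n. \<Sum>i<n. real (tail_seq k d i) / q ^ Suc i) \<longlonglongrightarrow> r k"
    unfolding part using tendsto_diff[OF tendsto_const, of _ 0 sequentially "r k"] by simp
  moreover have "(\<lambda>n. \<Sum>i<n. real (tail_seq k d i) / q ^ Suc i) \<longlonglongrightarrow> seq_value q (tail_seq k d)"
    using seq_value_sums[OF assms(1) tail_seq_in_digit_seqs[OF assms(2)]] by (simp add: sums_def)
  ultimately show ?thesis by (rule LIMSEQ_unique[symmetric])
qed

text \<open>The quasi-greedy algorithm: the remainders never vanish, so the expansion is infinite.\<close>

lemma quasi_greedy_expansion:
  assumes q: "1 < q" "q \<le> real M + 1" and x: "0 < x" "x \<le> real M / (q - 1)"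
  obtains d where "d \<in> digit_seqs M" "seq_value q d = x"
    "\<And>n. 0 < seq_value q (tail_seq n d)"
    "\<And>n. d n < M \<Longrightarrow> seq_value q (tail_seq (Suc n) d) \<le> 1"
proof -
  \<comment> \<open>The ceiling minus one is the largest integer strictly below
    \<open>q * y\<close>; the floor would give the greedy expansion, whose remainder can become
    0.\<close>
  define dig where "dig y = min M (nat (\<lceil>q * y\<rceil> - 1))" for y
  define r where "r = rec_nat x (\<lambda>_ y. q * y - real (dig y))"
  define d where "d n = dig (r n)" for n
  have r0: "r 0 = x" and rS: "r (Suc n) = q * r n - real (d n)" for n
    by (simp_all add: r_def d_def)
  have one: "1 \<le> real M / (q - 1)" using q by (simp add: field_simps)
  have dig_step: "0 < q * y - real (dig y) \<and> q * y - real (dig y) \<le> real M / (q - 1)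
      \<and> (dig y < M \<longrightarrow> q * y - real (dig y) \<le> 1)"
    if y: "0 < y" "y \<le> real M / (q - 1)" for y
  proof -
    have pos: "0 < q * y" using y q by simp
    have nn: "real (nat (\<lceil>q * y\<rceil> - 1)) = of_int \<lceil>q * y\<rceil> - 1"
      using pos by simp
    have c: "of_int \<lceil>q * y\<rceil> - 1 < q * y" "q * y \<le> of_int \<lceil>q * y\<rceil>"
      by linarith+
    show ?thesis
    proof (cases "dig y < M")
      case True
      then have "dig y = nat (\<lceil>q * y\<rceil> - 1)" by (auto simp: dig_def)
      then have "real (dig y) = of_int \<lceil>q * y\<rceil> - 1" using nn by simp
      then show ?thesis using c one by linarith
    next
      case False
      then have d: "dig y = M" "M \<le> nat (\<lceil>q * y\<rceil> - 1)" by (auto simp: dig_def)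
      have "real M \<le> real (nat (\<lceil>q * y\<rceil> - 1))" using d(2) by linarith
      moreover have "q * y \<le> q * (real M / (q - 1))" using y q by (intro mult_left_mono) auto
      \<comment> \<open>\<open>M / (q - 1)\<close> is the fixed point of
        \<open>\<lambda>y. q * y - M\<close>, so the remainder stays in range when the digit is
        capped at \<open>M\<close>.\<close>
      moreover have "q * (real M / (q - 1)) - real M = real M / (q - 1)"
        using q by (simp add: field_simps)
      ultimately show ?thesis using d(1) nn c(1) by auto
    qed
  qed
  have inv: "0 < r n \<and> r n \<le> real M / (q - 1)" for n
    by (induction n) (use x r0 rS dig_step in \<open>auto simp: d_def\<close>)
  have D: "d \<in> digit_seqs M" by (simp add: digit_seqs_iff d_def dig_def)
  have val: "seq_value q (tail_seq k d) = r k" for k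
  proof (rule seq_value_eq_remainder[OF q(1) D, of r "real M / (q - 1)"])
    show "q * r n = real (d n) + r (Suc n)" for n using rS by simp
    show "\<bar>r n\<bar> \<le> real M / (q - 1)" for n using inv[of n] by simp
  qed
  show thesis
  proof (rule that[OF D])
    show "seq_value q d = x" using val[of 0] r0 by (simp add: tail_seq_def)
    show "0 < seq_value q (tail_seq n d)" for n using val inv by simp
    show "seq_value q (tail_seq (Suc n) d) \<le> 1" if "d n < M" for n
      using dig_step[of "r n"] inv[of n] that by (simp add: val rS d_def)
  qed
qed

lemma expansion_exists:
  assumes "1 < q" "q \<le> real M + 1" "x \<in> J_set M q"
  obtains d where "d \<in> digit_seqs M" "seq_value q d = x"
proof (cases "x = 0")
  case True
  then show ?thesis using that[of "\<lambda>_. 0"] by (simp add: digit_seqs_iff seq_value_def)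
next
  case False
  then show ?thesis
    using quasi_greedy_expansion[OF assms(1,2), of x] assms(3) that unfolding J_set_def by auto
qed

lemma infinite_seq_iff: "infinite_seq c \<longleftrightarrow> (\<forall>i. c i = 0) \<or> (\<forall>n. \<exists>i\<ge>n. c i > 0)"
proof -
  have "finite_seq c" if "c i > 0" "\<forall>j\<ge>n. c j = 0" for i n
  proof -
    define S where "S = {j. c j \<noteq> 0}"
    have "S \<subseteq> {..<n}" using that(2) unfolding S_def by (auto intro: leI simp: lessThan_def)
    then have fin: "finite S" by (rule finite_subset) simp
    have "Max S \<in> S" using fin that(1) by (intro Max_in) (auto simp: S_def)
    moreover have "c k = 0" if "k > Max S" for k
      using Max_ge[OF fin, of k] that by (auto simp: S_def)
    ultimately show ?thesis unfolding finite_seq_def S_def by blast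
  qed
  moreover have "\<not> finite_seq c" if inf: "\<forall>n. \<exists>i\<ge>n. c i > 0"
  proof
    assume "finite_seq c"
    then obtain n where n: "\<forall>k>n. c k = 0" unfolding finite_seq_def by blast
    obtain i where "i \<ge> Suc n" "c i > 0" using inf by blast
    then show False using n by (simp add: Suc_le_eq)
  qed
  moreover have "\<not> finite_seq c" if "\<forall>i. c i = 0"
    using that by (simp add: finite_seq_def)
  ultimately show ?thesis
    unfolding infinite_seq_def by (meson not_gr_zero)
qed

text \<open>For nonzero \<open>x\<close> the quasi-greedy expansion works. Its positive remainders
  give infinitely many nonzero digits; a digit below \<open>M\<close> followed only by digits
  \<open>M\<close> would leave the remainder \<open>M / (q - 1)\<close>, which exceeds 1 for
  \<open>q < M + 1\<close>, against the bound after such a digit.\<close>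

lemma doubly_infinite_expansion_exists:
  assumes q: "1 < q" "q < real M + 1" and x: "x \<in> J_set M q"
  obtains d where "d \<in> digit_seqs M" "seq_value q d = x" "doubly_infinite_seq M d"
proof (cases "x = 0")
  case True
  then show ?thesis
    using that[of "\<lambda>_. 0"]
    by (simp add: digit_seqs_iff seq_value_def doubly_infinite_seq_def coinfinite_seq_def infinite_seq_iff)
       (metis le_refl neq0_conv)
next
  case False
  then obtain d where d: "d \<in> digit_seqs M" "seq_value q d = x"
    "\<And>n. 0 < seq_value q (tail_seq n d)"
    "\<And>n. d n < M \<Longrightarrow> seq_value q (tail_seq (Suc n) d) \<le> 1"
    using quasi_greedy_expansion[of q M x] q x unfolding J_set_def by auto
  have "\<exists>i\<ge>n. d i > 0" for n
  proof (rule ccontr)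
    assume "\<not> ?thesis"
    then have "tail_seq n d = (\<lambda>_. 0)" by (auto simp: tail_seq_def)
    then show False using d(3)[of n] by (simp add: seq_value_def)
  qed
  moreover have "coinfinite_seq M d"
  proof -
    have "False" if fin: "finite_seq (\<lambda>i. M - d i)"
    proof -
      obtain n where n: "M - d n \<noteq> 0" "\<forall>k>n. M - d k = 0" using fin unfolding finite_seq_def by blast
      have "mirror M (tail_seq (Suc n) d) = (\<lambda>_. 0)" using n(2) by (auto simp: mirror_def tail_seq_def)
      then have "real M / (q - 1) = seq_value q (tail_seq (Suc n) d)"
        using seq_value_mirror[OF q(1) tail_seq_in_digit_seqs[OF d(1)], of "Suc n"] by (simp add: seq_value_def)
      also have "\<dots> \<le> 1" using d(4)[of n] n(1) by simp
      finally show False using q by (simp add: field_simps)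
    qed
    then show ?thesis unfolding coinfinite_seq_def infinite_seq_def by blast
  qed
  ultimately show ?thesis using that[OF d(1,2)] by (simp add: doubly_infinite_seq_def infinite_seq_iff)
qed

section \<open>Carries and the comparison of values with the lexicographic order\<close>

text \<open>This is a carry: one unit of digit \<open>n\<close> weighs as much as the value 1 in the
  tail behind it.\<close>

lemma bump_digit:
  assumes "q > 1" "c \<in> digit_seqs M" "d \<in> digit_seqs M" "c n < M"
    and "seq_value q (tail_seq (Suc n) c) = 1 + seq_value q d"
  shows "append_seq (Suc n) (c(n := Suc (c n))) d \<in> digit_seqs M"
    and "seq_value q (append_seq (Suc n) (c(n := Suc (c n))) d) = seq_value q c"
    and "append_seq (Suc n) (c(n := Suc (c n))) d \<noteq> c"
proof -
  let ?e = "append_seq (Suc n) (c(n := Suc (c n))) d"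
  show e: "?e \<in> digit_seqs M"
    using assms(2-4) by (auto simp: digit_seqs_iff append_seq_def)
  have "?e n = Suc (c n)" by (simp add: append_seq_def)
  then show "?e \<noteq> c" by (metis n_not_Suc_n)
  have "\<forall>i<n. c i = ?e i" by (simp add: append_seq_def)
  from seq_value_diff[OF assms(1,2) e this] have "(seq_value q ?e - seq_value q c) * q ^ Suc n = 0"
    using assms(5) \<open>?e n = Suc (c n)\<close> by (simp add: tail_append_seq)
  then show "seq_value q ?e = seq_value q c" using assms(1) by simp
qed

text \<open>A tail of value at least 1 leaves, after subtracting 1, a number that still has an
  expansion; carrying the 1 into digit \<open>n\<close> then gives a second expansion.\<close>

lemma unique_expansion_tail_less_one:
  assumes "1 < q" "q \<le> real M + 1" "c \<in> digit_seqs M"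
    and uniq: "\<And>d. d \<in> digit_seqs M \<Longrightarrow> seq_value q d = seq_value q c \<Longrightarrow> d = c"
    and "c n < M"
  shows "seq_value q (tail_seq (Suc n) c) < 1"
proof (rule ccontr)
  assume "\<not> ?thesis"
  then have "seq_value q (tail_seq (Suc n) c) - 1 \<in> J_set M q"
    using seq_value_le[OF assms(1) tail_seq_in_digit_seqs[OF assms(3)], of "Suc n"] by (simp add: J_set_def)
  then obtain d where d: "d \<in> digit_seqs M" "seq_value q d = seq_value q (tail_seq (Suc n) c) - 1"
    using expansion_exists assms(1,2) by blast
  then show False
    using bump_digit[OF assms(1,3) d(1) assms(5)] uniq by force
qed

lemma unique_mirror:
  assumes "1 < q" "c \<in> digit_seqs M"
    and uniq: "\<And>d. d \<in> digit_seqs M \<Longrightarrow> seq_value q d = seq_value q c \<Longrightarrow> d = c"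
    and "d \<in> digit_seqs M" "seq_value q d = seq_value q (mirror M c)"
  shows "d = mirror M c"
proof -
  have "seq_value q (mirror M d) = seq_value q c"
    using seq_value_mirror[OF assms(1,2)] seq_value_mirror[OF assms(1,4)] assms(5) by simp
  then have "mirror M d = c" using uniq by simp
  then show ?thesis using mirror_mirror[OF assms(4)] by simp
qed

text \<open>At the first difference \<open>e\<close> gains at least one unit, while the tail of
  \<open>d\<close> is worth at most that unit. Equality requires a gap of exactly 1, a tail of
  \<open>d\<close> of value 1 and a zero tail of \<open>e\<close>, so \<open>e\<close> is a carry
  made in \<open>d\<close>.\<close>

lemma seq_value_mono:
  assumes "q > 1" "d \<in> digit_seqs M" "e \<in> digit_seqs M" "d \<sqsubset> e"
    and vg: "\<And>k. d k < M \<Longrightarrow> seq_value q (tail_seq (Suc k) d) \<le> 1"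
  shows "seq_value q d \<le> seq_value q e"
    and "seq_value q d = seq_value q e \<Longrightarrow>
      \<exists>k. d k < M \<and> seq_value q (tail_seq (Suc k) d) = 1 \<and>
        e = append_seq (Suc k) (d(k := Suc (d k))) (\<lambda>_. 0)"
proof -
  obtain k where k: "\<forall>i<k. d i = e i" "d k < e k" using assms(4) lex_less_def by blast
  have dk: "d k < M" using k(2) assms(3) order.strict_trans2 by (auto simp: digit_seqs_iff)
  have nn: "0 \<le> seq_value q (tail_seq (Suc k) e)"
    by (rule seq_value_nonneg[OF assms(1) tail_seq_in_digit_seqs[OF assms(3)]])
  have eq: "(seq_value q e - seq_value q d) * q ^ Suc k =
    real (e k) - real (d k) + seq_value q (tail_seq (Suc k) e) - seq_value q (tail_seq (Suc k) d)"
    by (rule seq_value_diff[OF assms(1-3) k(1)])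
  have ge: "real (e k) - real (d k) \<ge> 1" using k(2) by linarith
  have pos: "q ^ Suc k > 0" using assms(1) by simp
  have "0 \<le> (seq_value q e - seq_value q d) * q ^ Suc k"
    using eq ge vg[OF dk] nn by linarith
  then have "0 \<le> seq_value q e - seq_value q d" using pos by (metis mult_less_0_iff not_less)
  then show "seq_value q d \<le> seq_value q e" by simp
  assume "seq_value q d = seq_value q e"
  then have z: "real (e k) - real (d k) = 1" "seq_value q (tail_seq (Suc k) e) = 0"
    "seq_value q (tail_seq (Suc k) d) = 1"
    using eq ge vg[OF dk] nn by auto
  have "tail_seq (Suc k) e i = 0" for i
    using seq_value_pos[OF assms(1) tail_seq_in_digit_seqs[OF assms(3)], of "Suc k" i] z(2) by force
  then have "tail_seq (Suc k) e = (\<lambda>_. 0)" by auto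
  moreover have "e = append_seq (Suc k) e (tail_seq (Suc k) e)" by (simp add: append_tail_seq)
  moreover have "append_seq (Suc k) e (\<lambda>_. 0) = append_seq (Suc k) (d(k := Suc (d k))) (\<lambda>_. 0)"
    using k(1) z(1) by (auto simp: append_seq_def fun_eq_iff less_Suc_eq)
  ultimately show "\<exists>k. d k < M \<and> seq_value q (tail_seq (Suc k) d) = 1 \<and>
        e = append_seq (Suc k) (d(k := Suc (d k))) (\<lambda>_. 0)"
    using dk z(3) by metis
qed

lemma lex_less_of_value_less:
  assumes "q > 1" "d \<in> digit_seqs M" "e \<in> digit_seqs M" "seq_value q e < seq_value q d"
    and "\<And>k. d k < M \<Longrightarrow> seq_value q (tail_seq (Suc k) d) \<le> 1"
  shows "e \<sqsubset> d"
  using seq_value_mono(1)[OF assms(1-3) _ assms(5)] assms(4) lex_linear[of e d] by force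

lemma expansions_mirror:
  assumes "q > 1" "c \<in> digit_seqs M"
  shows "bij_betw (mirror M) (expansions M q (seq_value q (mirror M c))) (expansions M q (seq_value q c))"
proof (rule bij_betwI[where g = "mirror M"])
  show "mirror M \<in> expansions M q (seq_value q (mirror M c)) \<rightarrow> expansions M q (seq_value q c)"
    and "mirror M \<in> expansions M q (seq_value q c) \<rightarrow> expansions M q (seq_value q (mirror M c))"
    using assms by (auto simp: expansions_iff seq_value_mirror)
  show "mirror M (mirror M d) = d" if "d \<in> expansions M q (seq_value q (mirror M c))" for d
    using that assms by (auto simp: expansions_iff intro: mirror_mirror)
  show "mirror M (mirror M d) = d" if "d \<in> expansions M q (seq_value q c)" for d
    using that assms by (auto simp: expansions_iff intro: mirror_mirror)
qed

lemma countable_infinite_eqpoll_nat: "countable A \<Longrightarrow> infinite A \<Longrightarrow> A \<approx> (UNIV :: nat set)"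
  using countableE_infinite unfolding eqpoll_def by metis

section \<open>Lexicographic description of the univoque sets\<close>

lemma lex_le_const_max: "c \<in> digit_seqs M \<Longrightarrow> c \<sqsubseteq> (\<lambda>_. M)"
  unfolding lex_not_less[symmetric] by (auto simp: lex_less_def digit_seqs_iff not_less)

lemma doubly_infinite_seq_mirror:
  "c \<in> digit_seqs M \<Longrightarrow> doubly_infinite_seq M (mirror M c) \<longleftrightarrow> doubly_infinite_seq M c"
  using mirror_mirror[of c M] unfolding doubly_infinite_seq_def coinfinite_seq_def
  by (auto simp: mirror_def)

lemma coinfinite_seq_mirror: "coinfinite_seq M c \<longleftrightarrow> infinite_seq (mirror M c)"
  by (simp add: coinfinite_seq_def mirror_def)

lemma finite_seq_bumped: "finite_seq (append_seq (Suc k) (c(k := Suc m)) (\<lambda>_. 0))"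
  unfolding finite_seq_def by (intro exI[of _ k]) (auto simp: append_seq_def)

text \<open>The positive digit excludes the zero sequence, which counts as infinite but can be the
  end of a finite sequence.\<close>

lemma infinite_seq_append:
  assumes "infinite_seq d" "0 < d i"
  shows "infinite_seq (append_seq n c d)"
proof -
  have "\<exists>j\<ge>k. 0 < append_seq n c d j" for k
  proof -
    have "\<forall>n. \<exists>i\<ge>n. d i > 0" using assms by (auto simp: infinite_seq_iff)
    then obtain j where "j \<ge> k" "0 < d j" by blast
    then show ?thesis by (intro exI[of _ "n + j"]) (simp add: append_seq_def)
  qed
  then show ?thesis by (simp add: infinite_seq_iff)
qed

lemma inj_bumped: "inj (\<lambda>k. append_seq (Suc k) (c(k := Suc (c k))) (\<lambda>_. 0))"
proof -
  have "append_seq (Suc k) (c(k := Suc (c k))) (\<lambda>_. 0) \<noteq> append_seq (Suc k') (c(k' := Suc (c k'))) (\<lambda>_. 0)"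
    if "k < k'" for k k'
  proof
    assume "append_seq (Suc k) (c(k := Suc (c k))) (\<lambda>_. 0) = append_seq (Suc k') (c(k' := Suc (c k'))) (\<lambda>_. 0)"
    from fun_cong[OF this, of k'] show False using that by (simp add: append_seq_def)
  qed
  then show ?thesis by (intro injI) (metis linorder_neqE_nat)
qed

text \<open>\<open>\<alpha>\<close> is the quasi-greedy expansion of 1. The last two assumptions are
  asymmetric on purpose: equality in \<open>alpha_tail\<close> marks the bases outside
  \<open>univoque_bases M\<close>, whereas equality in \<open>alpha_mirror\<close> is ruled out in
  the whole closure by \<open>antiperiodic_isolated\<close>.\<close>

locale univoque_closure_base =
  fixes M :: nat and q :: real and \<alpha> :: "nat \<Rightarrow> nat"
  assumes M_pos: "1 \<le> M" and q_gt_1: "1 < q"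
    and alpha_digits: "\<alpha> \<in> digit_seqs M" and alpha_value: "seq_value q \<alpha> = 1"
    and alpha_tail: "\<And>n. \<alpha> n < M \<Longrightarrow> tail_seq (Suc n) \<alpha> \<sqsubseteq> \<alpha>"
    and alpha_mirror: "\<And>n. 0 < \<alpha> n \<Longrightarrow> mirror M (tail_seq (Suc n) \<alpha>) \<sqsubset> \<alpha>"
begin

text \<open>This is the weak form of the lexicographic condition that characterises greedy
  expansions; \<open>strict\<close> is that condition itself. Each controls the larger expansions of
  the same number, and imposed on the reflection it controls the smaller ones.\<close>

definition quasi :: "(nat \<Rightarrow> nat) \<Rightarrow> bool" where
  "quasi c \<longleftrightarrow> c \<in> digit_seqs M \<and> (\<forall>n. c n < M \<longrightarrow> tail_seq (Suc n) c \<sqsubseteq> \<alpha>)"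

definition strict :: "(nat \<Rightarrow> nat) \<Rightarrow> bool" where
  "strict c \<longleftrightarrow> c \<in> digit_seqs M \<and> (\<forall>n. c n < M \<longrightarrow> tail_seq (Suc n) c \<sqsubset> \<alpha>)"

definition V_seqs :: "(nat \<Rightarrow> nat) set" where
  "V_seqs = {c \<in> digit_seqs M. quasi c \<and> quasi (mirror M c)}"

definition U_seqs :: "(nat \<Rightarrow> nat) set" where
  "U_seqs = {c \<in> digit_seqs M. strict c \<and> strict (mirror M c)}"

lemma quasi_alpha: "quasi \<alpha>"
  using alpha_digits alpha_tail by (simp add: quasi_def)

lemma strict_imp_quasi: "strict c \<Longrightarrow> quasi c"
  unfolding strict_def quasi_def using lex_less_imp_le by blast

lemma U_seqs_subset_V_seqs: "U_seqs \<subseteq> V_seqs"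
  unfolding U_seqs_def V_seqs_def using strict_imp_quasi by blast

lemma mirror_in_V_seqs: "c \<in> V_seqs \<Longrightarrow> mirror M c \<in> V_seqs"
  by (auto simp: V_seqs_def mirror_mirror)

lemma mirror_in_U_seqs: "c \<in> U_seqs \<Longrightarrow> mirror M c \<in> U_seqs"
  by (auto simp: U_seqs_def mirror_mirror)

lemma mirror_less_iff: "mirror M c n < M \<longleftrightarrow> 0 < c n"
  using M_pos by (auto simp: mirror_def)

lemma V_seqs_iff:
  "c \<in> V_seqs \<longleftrightarrow> c \<in> digit_seqs M
    \<and> (\<forall>n. (c n < M \<longrightarrow> tail_seq (Suc n) c \<sqsubseteq> \<alpha>) \<and> (0 < c n \<longrightarrow> mirror M (tail_seq (Suc n) c) \<sqsubseteq> \<alpha>))"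
  unfolding V_seqs_def quasi_def by (auto simp: tail_seq_mirror mirror_less_iff)

lemma U_seqs_iff:
  "c \<in> U_seqs \<longleftrightarrow> c \<in> digit_seqs M
    \<and> (\<forall>n. (c n < M \<longrightarrow> tail_seq (Suc n) c \<sqsubset> \<alpha>) \<and> (0 < c n \<longrightarrow> mirror M (tail_seq (Suc n) c) \<sqsubset> \<alpha>))"
  unfolding U_seqs_def strict_def by (auto simp: tail_seq_mirror mirror_less_iff)

lemma q_le: "q \<le> real M + 1"
  using seq_value_le[OF q_gt_1 alpha_digits] alpha_value q_gt_1 by (simp add: field_simps)

lemma alpha_nonzero: "\<exists>i. 0 < \<alpha> i"
proof (rule ccontr)
  assume "\<not> ?thesis"
  then have "\<alpha> = (\<lambda>_. 0)" by auto
  then show False using alpha_value by (simp add: seq_value_def)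
qed

text \<open>After a last nonzero digit the reflected tail would be constantly \<open>M\<close>, the
  largest sequence, and could not be strictly below \<open>\<alpha>\<close>.\<close>

lemma alpha_infinite: "\<exists>i\<ge>n. 0 < \<alpha> i"
proof (rule ccontr)
  assume "\<not> ?thesis"
  then have "\<not> infinite_seq \<alpha>" using alpha_nonzero by (auto simp: infinite_seq_iff)
  then obtain k where k: "\<alpha> k \<noteq> 0" "\<forall>i>k. \<alpha> i = 0" unfolding infinite_seq_def finite_seq_def by blast
  have "mirror M (tail_seq (Suc k) \<alpha>) = (\<lambda>_. M)" using k(2) by (auto simp: mirror_def tail_seq_def)
  then show False
    using alpha_mirror[of k] k(1) lex_le_const_max[OF alpha_digits] lex_not_less by auto
qed

text \<open>If \<open>\<alpha>\<close> began with 0, the tail starting at its first positive digit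
  would follow a digit 0 and exceed \<open>\<alpha>\<close>.\<close>

lemma alpha_0_pos: "0 < \<alpha> 0"
proof (rule ccontr)
  assume 0: "\<not> ?thesis"
  define k where "k = (LEAST i. 0 < \<alpha> i)"
  have k: "0 < \<alpha> k" unfolding k_def using alpha_nonzero LeastI_ex by metis
  then obtain j where j: "k = Suc j" using 0 by (cases k) auto
  have "\<alpha> j = 0" using not_less_Least[of j "\<lambda>i. 0 < \<alpha> i"] j unfolding k_def by auto
  then have "tail_seq k \<alpha> \<sqsubseteq> \<alpha>" using alpha_tail[of j] M_pos j by simp
  moreover have "\<alpha> \<sqsubset> tail_seq k \<alpha>" using 0 k unfolding lex_less_def tail_seq_def by (intro exI[of _ 0]) auto
  ultimately show False using lex_not_less by blast
qed

section \<open>Values of the tails of quasi-greedy sequences\<close>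

text \<open>At the first difference between the tail and \<open>\<alpha>\<close> the digit gap is at
  least 1, and the remaining tail of \<open>\<alpha>\<close> is positive, which makes the estimate
  strict. The digit at \<open>k\<close> is again below \<open>M\<close>, so the comparison can be
  repeated from there.\<close>

lemma quasi_step:
  assumes "quasi c" "c n < M" "tail_seq (Suc n) c \<noteq> \<alpha>"
  obtains k where "n < k" "c k < M"
    "1 - seq_value q (tail_seq (Suc n) c) > (1 - seq_value q (tail_seq (Suc k) c)) / q ^ (k - n)"
proof -
  let ?t = "tail_seq (Suc n) c"
  have c: "c \<in> digit_seqs M" "?t \<sqsubset> \<alpha>"
    using assms by (auto simp: quasi_def lex_le_def)
  obtain k where k: "\<forall>i<k. ?t i = \<alpha> i" "?t k < \<alpha> k" using c(2) lex_less_def by blast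
  have t: "?t \<in> digit_seqs M" by (rule tail_seq_in_digit_seqs[OF c(1)])
  have "\<exists>i. 0 < tail_seq (Suc k) \<alpha> i"
    using alpha_infinite[of "Suc k"] by (metis le_Suc_ex tail_seq_def)
  then have pos: "0 < seq_value q (tail_seq (Suc k) \<alpha>)"
    using seq_value_pos[OF q_gt_1 tail_seq_in_digit_seqs[OF alpha_digits]] by blast
  have eq: "(1 - seq_value q ?t) * q ^ Suc k = real (\<alpha> k) - real (?t k)
      + seq_value q (tail_seq (Suc k) \<alpha>) - seq_value q (tail_seq (Suc (Suc n + k)) c)"
    using seq_value_diff[OF q_gt_1 t alpha_digits k(1)] alpha_value
    by (simp add: tail_seq_tail_seq)
  have "real (\<alpha> k) - real (?t k) \<ge> 1" using k(2) by linarith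
  then have "(1 - seq_value q ?t) * q ^ Suc k > 1 - seq_value q (tail_seq (Suc (Suc n + k)) c)"
    using eq pos by linarith
  then have "1 - seq_value q ?t > (1 - seq_value q (tail_seq (Suc (Suc n + k)) c)) / q ^ Suc k"
    using q_gt_1 by (simp add: pos_divide_less_eq)
  moreover have "c (Suc n + k) < M"
    using k(2) alpha_digits order.strict_trans2 by (auto simp: tail_seq_def digit_seqs_iff)
  moreover have "Suc n + k - n = Suc k" by simp
  ultimately show thesis using that[of "Suc n + k"] by simp
qed

text \<open>Iterating \<open>quasi_step\<close>: the excess over 1 is at most \<open>K\<close> for
  every such tail and shrinks by a factor of at least \<open>q\<close> per step, so it is at most
  \<open>K / q ^ p\<close> for every \<open>p\<close>. A tail equal to \<open>\<alpha>\<close> has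
  excess 0 and ends the iteration.\<close>

lemma quasi_value_le:
  assumes "quasi c" "c n < M"
  shows "seq_value q (tail_seq (Suc n) c) \<le> 1"
proof -
  define K where "K = real M / (q - 1)"
  have K: "0 \<le> K" using q_gt_1 by (simp add: K_def)
  have bd: "seq_value q (tail_seq (Suc n) c) - 1 \<le> K / q ^ p" if "c n < M" for n p
    using that
  proof (induction p arbitrary: n)
    case 0
    have "c \<in> digit_seqs M" using assms(1) by (simp add: quasi_def)
    from seq_value_le[OF q_gt_1 tail_seq_in_digit_seqs[OF this], of "Suc n"]
    show ?case by (simp add: K_def)
  next
    case (Suc p)
    show ?case
    proof (cases "tail_seq (Suc n) c = \<alpha>")
      case True
      then show ?thesis using alpha_value K q_gt_1 by simp
    next
      case False
      then obtain k where k: "n < k" "c k < M"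
        "1 - seq_value q (tail_seq (Suc n) c) > (1 - seq_value q (tail_seq (Suc k) c)) / q ^ (k - n)"
        using quasi_step[OF assms(1) Suc.prems] by blast
      have "seq_value q (tail_seq (Suc n) c) - 1 \<le> (seq_value q (tail_seq (Suc k) c) - 1) / q ^ (k - n)"
        using k(3) by (simp add: diff_divide_distrib)
      also have "\<dots> \<le> (K / q ^ p) / q ^ (k - n)"
        using Suc.IH[OF k(2)] q_gt_1 by (intro divide_right_mono) auto
      also have "\<dots> \<le> (K / q ^ p) / q ^ 1"
        using K q_gt_1 k(1) by (intro divide_left_mono power_increasing mult_pos_pos) auto
      finally show ?thesis by (simp add: mult.commute)
    qed
  qed
  have "(\<lambda>p. K / q ^ p) \<longlonglongrightarrow> 0" by (rule LIMSEQ_divide_realpow_zero[OF q_gt_1])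
  then have "seq_value q (tail_seq (Suc n) c) - 1 \<le> 0"
    by (rule LIMSEQ_le_const) (use bd assms(2) in blast)
  then show ?thesis by simp
qed

text \<open>For any other tail the strict inequality of \<open>quasi_step\<close> puts the deficit
  above a quantity that is nonnegative by \<open>quasi_value_le\<close>.\<close>

lemma quasi_value_eq:
  assumes "quasi c" "c n < M" "seq_value q (tail_seq (Suc n) c) = 1"
  shows "tail_seq (Suc n) c = \<alpha>"
proof (rule ccontr)
  assume "\<not> ?thesis"
  then obtain k where k: "n < k" "c k < M"
    "1 - seq_value q (tail_seq (Suc n) c) > (1 - seq_value q (tail_seq (Suc k) c)) / q ^ (k - n)"
    using quasi_step[OF assms(1,2)] by blast
  have "0 \<le> (1 - seq_value q (tail_seq (Suc k) c)) / q ^ (k - n)"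
    using quasi_value_le[OF assms(1) k(2)] q_gt_1 by (intro divide_nonneg_nonneg) auto
  then show False using k(3) assms(3) by linarith
qed

section \<open>Other expansions of the same number, and the sets \<open>U_set\<close> and
  \<open>V_set\<close>\<close>

text \<open>This is the equality case of \<open>seq_value_mono\<close>: the tail of \<open>c\<close>
  behind the raised digit has value 1 and is therefore \<open>\<alpha>\<close>.\<close>

lemma larger_expansion:
  assumes "quasi c" "d \<in> digit_seqs M" "seq_value q d = seq_value q c" "c \<sqsubset> d"
  obtains k where "c k < M" "tail_seq (Suc k) c = \<alpha>"
    "d = append_seq (Suc k) (c(k := Suc (c k))) (\<lambda>_. 0)"
proof -
  have "c \<in> digit_seqs M" using assms(1) by (simp add: quasi_def)
  from seq_value_mono(2)[OF q_gt_1 this assms(2,4) quasi_value_le[OF assms(1)] assms(3)[symmetric]]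
  show thesis using that quasi_value_eq[OF assms(1)] by blast
qed

text \<open>Reflection reverses the order and turns this into \<open>larger_expansion\<close> for
  \<open>mirror M c\<close>.\<close>

lemma smaller_expansion:
  assumes "c \<in> V_seqs" "d \<in> digit_seqs M" "seq_value q d = seq_value q c" "d \<sqsubset> c"
  obtains k where "0 < c k" "mirror M (tail_seq (Suc k) c) = \<alpha>"
    "mirror M d = append_seq (Suc k) ((mirror M c)(k := Suc (mirror M c k))) (\<lambda>_. 0)"
proof -
  have c: "c \<in> digit_seqs M" "quasi (mirror M c)" using assms(1) by (auto simp: V_seqs_def)
  have "seq_value q (mirror M d) = seq_value q (mirror M c)"
    using seq_value_mirror[OF q_gt_1 c(1)] seq_value_mirror[OF q_gt_1 assms(2)] assms(3) by simp
  from larger_expansion[OF c(2) mirror_in_digit_seqs this lex_less_mirror[OF assms(2) c(1) assms(4)]]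
  obtain k where k: "mirror M c k < M" "tail_seq (Suc k) (mirror M c) = \<alpha>"
    "mirror M d = append_seq (Suc k) ((mirror M c)(k := Suc (mirror M c k))) (\<lambda>_. 0)" by blast
  have "0 < c k" using k(1) by (auto simp: mirror_def)
  then show thesis using that k by (simp add: tail_seq_mirror)
qed

text \<open>Any other expansion, larger or smaller, would require a tail or reflected tail equal to
  \<open>\<alpha>\<close>, which the strict inequalities forbid.\<close>

lemma U_seqs_unique:
  assumes "c \<in> U_seqs" "d \<in> digit_seqs M" "seq_value q d = seq_value q c"
  shows "d = c"
proof (rule ccontr)
  assume "d \<noteq> c"
  then consider "c \<sqsubset> d" | "d \<sqsubset> c" using lex_linear[of c d] by auto
  then show False
  proof cases
    case 1
    have "quasi c" using assms(1) strict_imp_quasi by (simp add: U_seqs_def)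
    from larger_expansion[OF this assms(2,3) 1] show False
      using assms(1) lex_irrefl unfolding U_seqs_iff by metis
  next
    case 2
    have "c \<in> V_seqs" using assms(1) U_seqs_subset_V_seqs by blast
    from smaller_expansion[OF this assms(2,3) 2] show False
      using assms(1) lex_irrefl unfolding U_seqs_iff by metis
  qed
qed

text \<open>Uniqueness keeps the tails below 1 in value, and since \<open>\<alpha>\<close> is itself
  \<open>quasi\<close>, a value below that of \<open>\<alpha>\<close> means a lexicographically
  smaller sequence. The same argument applies to the reflection.\<close>

lemma unique_imp_U_seqs:
  assumes "c \<in> digit_seqs M"
    and "\<And>d. d \<in> digit_seqs M \<Longrightarrow> seq_value q d = seq_value q c \<Longrightarrow> d = c"
  shows "c \<in> U_seqs"
proof -
  have *: "strict d" if d: "d \<in> digit_seqs M"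
    and uniq: "\<And>e. e \<in> digit_seqs M \<Longrightarrow> seq_value q e = seq_value q d \<Longrightarrow> e = d" for d
    unfolding strict_def
  proof (intro conjI allI impI d)
    fix n assume "d n < M"
    then have "seq_value q (tail_seq (Suc n) d) < seq_value q \<alpha>"
      using unique_expansion_tail_less_one[OF q_gt_1 q_le d uniq] alpha_value by simp
    then show "tail_seq (Suc n) d \<sqsubset> \<alpha>"
      using lex_less_of_value_less[OF q_gt_1 alpha_digits tail_seq_in_digit_seqs[OF d]]
        quasi_value_le[OF quasi_alpha] by blast
  qed
  show ?thesis
    using *[OF assms] *[OF mirror_in_digit_seqs] unique_mirror[OF q_gt_1 assms] assms(1)
    unfolding U_seqs_def by blast
qed

lemma U_set_eq: "U_set M q = seq_value q ` U_seqs"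
proof (intro equalityI subsetI)
  fix x assume "x \<in> U_set M q"
  then obtain c where "c \<in> digit_seqs M" "seq_value q c = x"
    "\<And>d. d \<in> digit_seqs M \<Longrightarrow> seq_value q d = x \<Longrightarrow> d = c"
    unfolding U_set_def expansions_iff[OF q_gt_1] by blast
  then show "x \<in> seq_value q ` U_seqs" using unique_imp_U_seqs by blast
next
  fix x assume "x \<in> seq_value q ` U_seqs"
  then obtain c where "c \<in> U_seqs" "x = seq_value q c" by blast
  then show "x \<in> U_set M q"
    unfolding U_set_def expansions_iff[OF q_gt_1]
    using U_seqs_unique seq_value_in_J_set[OF q_gt_1, of c M] by (auto simp: U_seqs_def)
qed

lemma univoque_base_iff: "q \<in> univoque_bases M \<longleftrightarrow> \<alpha> \<in> U_seqs"
proof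
  assume "q \<in> univoque_bases M"
  then have "\<exists>!c. c \<in> digit_seqs M \<and> seq_value q c = 1"
    unfolding univoque_bases_def expansions_iff[OF q_gt_1] using expansions_iff[OF q_gt_1] by simp
  then show "\<alpha> \<in> U_seqs" using unique_imp_U_seqs[OF alpha_digits] alpha_digits alpha_value by metis
next
  assume "\<alpha> \<in> U_seqs"
  then have "\<exists>!c. c \<in> digit_seqs M \<and> seq_value q c = 1"
    using U_seqs_unique alpha_digits alpha_value by metis
  then show "q \<in> univoque_bases M"
    unfolding univoque_bases_def using expansions_iff[OF q_gt_1] q_gt_1 by simp
qed

text \<open>This singles out the base with a separate definition of \<open>V_set\<close>: there 1 is
  the right end point of \<open>J_set M q\<close>, so the reflection of \<open>\<alpha>\<close> has
  value 0.\<close>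

lemma alpha_const_max_iff: "q = real M + 1 \<longleftrightarrow> \<alpha> = (\<lambda>_. M)"
proof
  assume "\<alpha> = (\<lambda>_. M)"
  then have "real M / (q - 1) = 1"
    using alpha_value geometric_digit_sums[OF q_gt_1, of M] by (simp add: seq_value_def sums_iff)
  then show "q = real M + 1" using q_gt_1 by (simp add: field_simps)
next
  assume q: "q = real M + 1"
  then have 0: "seq_value q (mirror M \<alpha>) = 0"
    using seq_value_mirror[OF q_gt_1 alpha_digits] alpha_value M_pos by simp
  have "M - \<alpha> i = 0" for i
    using seq_value_pos[OF q_gt_1 mirror_in_digit_seqs, of M \<alpha> i] 0 by (force simp: mirror_def)
  then show "\<alpha> = (\<lambda>_. M)" using alpha_digits by (auto simp: digit_seqs_iff le_antisym)
qed

text \<open>Behind a last nonzero digit the reflected tail is constantly \<open>M\<close>; being at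
  most \<open>\<alpha>\<close>, it forces \<open>\<alpha>\<close> to be constantly \<open>M\<close>
  as well.\<close>

lemma V_seqs_infinite_seq:
  assumes "c \<in> V_seqs" "q \<noteq> real M + 1"
  shows "infinite_seq c"
  unfolding infinite_seq_def
proof
  assume "finite_seq c"
  then obtain n where n: "c n \<noteq> 0" "\<forall>k>n. c k = 0" unfolding finite_seq_def by blast
  have "mirror M (tail_seq (Suc n) c) = (\<lambda>_. M)" using n(2) by (auto simp: mirror_def tail_seq_def)
  then have "(\<lambda>_. M) \<sqsubseteq> \<alpha>" using assms(1) n(1) unfolding V_seqs_iff by (metis not_gr_zero)
  then have "\<alpha> = (\<lambda>_. M)"
    using lex_le_const_max[OF alpha_digits] unfolding lex_le_def using lex_trans lex_irrefl by metis
  then show False using alpha_const_max_iff assms(2) by blast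
qed

text \<open>Every other expansion is a carry followed by zeros, or the reflection of one, and so it
  is not doubly infinite.\<close>

lemma V_seqs_unique:
  assumes "c \<in> V_seqs" "d \<in> digit_seqs M" "seq_value q d = seq_value q c" "doubly_infinite_seq M d"
  shows "d = c"
proof (rule ccontr)
  assume "d \<noteq> c"
  then consider "c \<sqsubset> d" | "d \<sqsubset> c" using lex_linear[of c d] by auto
  then show False
  proof cases
    case 1
    have "quasi c" using assms(1) by (simp add: V_seqs_def)
    from larger_expansion[OF this assms(2,3) 1] show False
      using assms(4) finite_seq_bumped unfolding doubly_infinite_seq_def infinite_seq_def by metis
  next
    case 2
    from smaller_expansion[OF assms(1-3) 2] show False
      using assms(4) finite_seq_bumped
      unfolding doubly_infinite_seq_def coinfinite_seq_mirror infinite_seq_def by metis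
  qed
qed

text \<open>A tail above \<open>\<alpha>\<close> has value greater than 1, since equality would make
  it a carry ending in zeros. Carrying 1 out of it and continuing with a doubly infinite expansion
  of the rest produces a second doubly infinite expansion.\<close>

lemma doubly_infinite_unique_imp_quasi:
  assumes q: "q \<noteq> real M + 1" and c: "c \<in> digit_seqs M" "doubly_infinite_seq M c"
    and uniq: "\<And>d. d \<in> digit_seqs M \<Longrightarrow> seq_value q d = seq_value q c \<Longrightarrow> doubly_infinite_seq M d \<Longrightarrow> d = c"
  shows "quasi c"
  unfolding quasi_def
proof (intro conjI allI impI c(1), rule ccontr)
  fix n assume n: "c n < M" "\<not> tail_seq (Suc n) c \<sqsubseteq> \<alpha>"
  let ?t = "tail_seq (Suc n) c"
  have t: "?t \<in> digit_seqs M" by (rule tail_seq_in_digit_seqs[OF c(1)])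
  have less: "\<alpha> \<sqsubset> ?t" using n(2) lex_not_le by blast
  note mono = seq_value_mono[OF q_gt_1 alpha_digits t less quasi_value_le[OF quasi_alpha]]
  have "seq_value q \<alpha> \<noteq> seq_value q ?t"
  proof
    assume "seq_value q \<alpha> = seq_value q ?t"
    then obtain k m where "?t = append_seq (Suc k) (\<alpha>(k := Suc m)) (\<lambda>_. 0)" using mono(2) by blast
    then obtain j where "?t j \<noteq> 0" "\<forall>i>j. ?t i = 0" using finite_seq_bumped unfolding finite_seq_def by metis
    then have "finite_seq c"
      unfolding finite_seq_def tail_seq_def
      by (intro exI[of _ "Suc n + j"]) (metis le_Suc_ex less_imp_le_nat nat_add_left_cancel_less add_lessD1)
    then show False using c(2) unfolding doubly_infinite_seq_def infinite_seq_def by blast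
  qed
  then have gt: "1 < seq_value q ?t" using mono(1) alpha_value by simp
  have le: "seq_value q ?t \<le> real M / (q - 1)" by (rule seq_value_le[OF q_gt_1 t])
  have "seq_value q ?t - 1 \<in> J_set M q" using gt le by (simp add: J_set_def)
  then obtain d where d: "d \<in> digit_seqs M" "seq_value q d = seq_value q ?t - 1" "doubly_infinite_seq M d"
    using doubly_infinite_expansion_exists[OF q_gt_1] q q_le by (metis order_le_less)
  let ?e = "append_seq (Suc n) (c(n := Suc (c n))) d"
  have e: "?e \<in> digit_seqs M" "seq_value q ?e = seq_value q c" "?e \<noteq> c"
    using bump_digit[OF q_gt_1 c(1) d(1) n(1)] d(2) by auto
  \<comment> \<open>The rest lies strictly between 0 and \<open>M / (q - 1)\<close>, so neither
    \<open>d\<close> nor its reflection is the zero sequence, and infinitude passes to the appended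
    sequence.\<close>
  have "infinite_seq ?e"
  proof -
    have "d \<noteq> (\<lambda>_. 0)" using d(2) gt by (auto simp: seq_value_def)
    then obtain i where "0 < d i" by auto
    then show ?thesis using infinite_seq_append d(3) by (simp add: doubly_infinite_seq_def)
  qed
  moreover have "coinfinite_seq M ?e"
  proof -
    have "seq_value q (mirror M d) \<noteq> 0" using seq_value_mirror[OF q_gt_1 d(1)] d(2) le by simp
    then have "mirror M d \<noteq> (\<lambda>_. 0)" by (auto simp: seq_value_def)
    then obtain i where "0 < mirror M d i" by auto
    then show ?thesis
      using infinite_seq_append d(3) unfolding coinfinite_seq_mirror mirror_append_seq doubly_infinite_seq_def
      by blast
  qed
  ultimately show False using uniq e by (simp add: doubly_infinite_seq_def)
qed

lemma V_set_eq: "V_set M q = seq_value q ` V_seqs"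
proof (cases "q = real M + 1")
  case True
  then have "\<alpha> = (\<lambda>_. M)" using alpha_const_max_iff by blast
  \<comment> \<open>With \<open>\<alpha>\<close> constantly \<open>M\<close> all the lexicographic
    bounds are vacuous.\<close>
  then have "V_seqs = digit_seqs M"
    unfolding V_seqs_iff set_eq_iff by (auto intro!: lex_le_const_max tail_seq_in_digit_seqs)
  then show ?thesis
    using True expansion_exists[OF q_gt_1 q_le] seq_value_in_J_set[OF q_gt_1] unfolding V_set_def
    by (auto simp: image_iff) metis
next
  case False
  show ?thesis
  proof (intro equalityI subsetI)
    fix x assume "x \<in> V_set M q"
    then have "\<exists>!c. (c \<in> digit_seqs M \<and> seq_value q c = x) \<and> doubly_infinite_seq M c"
      using False by (simp add: V_set_def expansions_iff[OF q_gt_1])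
    then obtain c where c: "c \<in> digit_seqs M" "seq_value q c = x" "doubly_infinite_seq M c"
      and uniq: "\<And>d. d \<in> digit_seqs M \<Longrightarrow> seq_value q d = x \<Longrightarrow> doubly_infinite_seq M d \<Longrightarrow> d = c"
      by blast
    have "quasi c" using doubly_infinite_unique_imp_quasi[OF False c(1,3)] uniq c(2) by blast
    moreover have "quasi (mirror M c)"
    proof (rule doubly_infinite_unique_imp_quasi[OF False])
      show "doubly_infinite_seq M (mirror M c)" using c doubly_infinite_seq_mirror by blast
      fix d assume d: "d \<in> digit_seqs M" "seq_value q d = seq_value q (mirror M c)" "doubly_infinite_seq M d"
      have "seq_value q (mirror M d) = x"
        using d(2) c(2) seq_value_mirror[OF q_gt_1 d(1)] seq_value_mirror[OF q_gt_1 c(1)] by simp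
      then have "mirror M d = c" using uniq d doubly_infinite_seq_mirror by simp
      then show "d = mirror M c" using mirror_mirror[OF d(1)] by simp
    qed simp
    ultimately show "x \<in> seq_value q ` V_seqs" using c(1,2) by (auto simp: V_seqs_def)
  next
    fix x assume "x \<in> seq_value q ` V_seqs"
    then obtain c where c: "c \<in> V_seqs" "x = seq_value q c" by blast
    have D: "c \<in> digit_seqs M" using c(1) by (simp add: V_seqs_def)
    have "doubly_infinite_seq M c"
      using V_seqs_infinite_seq[OF c(1) False] V_seqs_infinite_seq[OF mirror_in_V_seqs[OF c(1)] False]
      by (simp add: doubly_infinite_seq_def coinfinite_seq_mirror)
    then show "x \<in> V_set M q"
      using False V_seqs_unique[OF c(1)] c(2) D seq_value_in_J_set[OF q_gt_1 D]
      unfolding V_set_def by (auto simp: expansions_iff[OF q_gt_1])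
  qed
qed

section \<open>Approximation of sequences\<close>

text \<open>Equality would make all digits \<open>M / 2\<close> and turn \<open>alpha_mirror\<close>
  into an equality. If the reflection were larger, the digit at the first difference would be below
  \<open>M / 2\<close>: at position 0 this contradicts the bounds of \<open>\<alpha> 1\<close> and
  \<open>M - \<alpha> 1\<close> by \<open>\<alpha> 0\<close>, and at a later \<open>w\<close> the
  bound of \<open>M - \<alpha> w\<close> by \<open>\<alpha> 0\<close>.\<close>

lemma alpha_mirror_less: "mirror M \<alpha> \<sqsubset> \<alpha>"
proof (rule ccontr)
  assume "\<not> ?thesis"
  then consider "\<alpha> = mirror M \<alpha>" | "\<alpha> \<sqsubset> mirror M \<alpha>"
    using lex_not_less lex_le_def by auto
  then show False
  proof cases
    case 1
    have d: "\<alpha> i = M - \<alpha> i" for i using 1 unfolding mirror_def by (rule fun_cong)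
    have "mirror M (tail_seq (Suc 0) \<alpha>) = \<alpha>"
    proof
      fix i
      show "mirror M (tail_seq (Suc 0) \<alpha>) i = \<alpha> i"
        using d[of i] d[of "Suc i"] by (simp add: mirror_def tail_seq_def)
    qed
    then show False using alpha_mirror[OF alpha_0_pos] lex_irrefl by metis
  next
    case 2
    then obtain w where w: "\<forall>i<w. \<alpha> i = M - \<alpha> i" "\<alpha> w < M - \<alpha> w"
      unfolding lex_less_def mirror_def by blast
    show False
    proof (cases w)
      case 0
      have "\<alpha> 0 < M" using w(2) 0 by simp
      then have "tail_seq (Suc 0) \<alpha> \<sqsubseteq> \<alpha>" by (rule alpha_tail)
      then have "\<alpha> 1 \<le> \<alpha> 0" unfolding lex_not_less[symmetric] lex_less_def tail_seq_def
        by (metis One_nat_def add.right_neutral leI not_less_zero)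
      moreover have "M - \<alpha> 1 \<le> \<alpha> 0"
        using alpha_mirror[OF alpha_0_pos, THEN lex_less_imp_le]
        unfolding lex_not_less[symmetric] lex_less_def tail_seq_def mirror_def
        by (metis One_nat_def add.right_neutral leI not_less_zero)
      ultimately show False using w(2) 0 by simp
    next
      case (Suc v)
      have v: "\<alpha> v = M - \<alpha> v" "\<alpha> 0 = M - \<alpha> 0" using w(1) Suc by blast+
      have "0 < \<alpha> v" using v M_pos by linarith
      from alpha_mirror[OF this, THEN lex_less_imp_le] have "M - \<alpha> w \<le> \<alpha> 0"
        unfolding lex_not_less[symmetric] lex_less_def tail_seq_def mirror_def Suc
        by (metis add.right_neutral leI not_less_zero)
      then show False using w(2) v M_pos by linarith
    qed
  qed
qed

section \<open>Good positions and antiperiodic approximations of \<open>\<alpha>\<close>\<close>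

text \<open>Position \<open>n\<close> is good if no reflected block of \<open>c\<close> ending at \<open>n\<close> is a prefix of \<open>\<alpha>\<close>.\<close>

definition good :: "(nat \<Rightarrow> nat) \<Rightarrow> nat \<Rightarrow> bool" where
  "good c n \<longleftrightarrow> 0 < c n \<and> (\<forall>k<n. 0 < c k \<longrightarrow> \<not> (\<forall>i. Suc k + i \<le> n \<longrightarrow> M - c (Suc k + i) = \<alpha> i))"

text \<open>If the inequality were undecided up to \<open>n\<close>, the reflected block ending
  there would be a prefix of \<open>\<alpha>\<close>. So it is decided by digits that remain when
  the sequence is altered behind \<open>n\<close>.\<close>

lemma good_witness:
  assumes "good c n" "k < n" "0 < c k" "mirror M (tail_seq (Suc k) c) \<sqsubset> \<alpha>"
  obtains l where "Suc k + l \<le> n" "M - c (Suc k + l) < \<alpha> l" "\<forall>i<l. M - c (Suc k + i) = \<alpha> i"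
proof -
  obtain l where l: "\<forall>i<l. M - c (Suc k + i) = \<alpha> i" "M - c (Suc k + l) < \<alpha> l"
    using assms(4) unfolding lex_less_def mirror_def tail_seq_def by blast
  have "Suc k + l \<le> n"
  proof (rule ccontr)
    assume "\<not> ?thesis"
    then have "\<forall>i. Suc k + i \<le> n \<longrightarrow> M - c (Suc k + i) = \<alpha> i" using l(1) by auto
    then show False using assms(1-3) unfolding good_def by blast
  qed
  then show thesis using that l by blast
qed

text \<open>The smallest obstruction to goodness of a position is itself a good position; so if only
  finitely many positions were good, one of them would obstruct infinitely many others.\<close>

lemma obstruction_good:
  assumes c: "c \<in> digit_seqs M" "\<And>k. 0 < c k \<Longrightarrow> mirror M (tail_seq (Suc k) c) \<sqsubset> \<alpha>"
    and n: "0 < c n" "\<not> good c n"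
  obtains k where "k < n" "good c k" "\<forall>i. Suc k + i \<le> n \<longrightarrow> M - c (Suc k + i) = \<alpha> i"
proof -
  define bad where "bad k n \<longleftrightarrow> k < n \<and> 0 < c k \<and> (\<forall>i. Suc k + i \<le> n \<longrightarrow> M - c (Suc k + i) = \<alpha> i)" for k n
  have goodI: "good c k" if "0 < c k" "\<And>k'. \<not> bad k' k" for k
    using that unfolding good_def bad_def by blast
  define k where "k = (LEAST k. bad k n)"
  have "\<exists>k. bad k n" using n goodI by blast
  then have k: "bad k n" unfolding k_def by (rule LeastI_ex)
  have "\<not> bad k' k" for k'
  proof
    assume k': "bad k' k"
    then have "k' < k" by (simp add: bad_def)
    then have nb: "\<not> bad k' n" unfolding k_def by (rule not_less_Least)
    \<comment> \<open>The match started at \<open>k'\<close> breaks at offset \<open>j\<close>. This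
      happens behind \<open>k\<close>, because \<open>k'\<close> obstructs \<open>k\<close>, and no
      later than \<open>n\<close>, because by minimality of \<open>k\<close> it does not obstruct
      \<open>n\<close>.\<close>
    obtain j where j: "\<forall>i<j. M - c (Suc k' + i) = \<alpha> i" "M - c (Suc k' + j) < \<alpha> j"
    proof -
      have "0 < c k'" using k' by (simp add: bad_def)
      from c(2)[OF this] show thesis
        using that unfolding lex_less_def mirror_def tail_seq_def by blast
    qed
    have jn: "Suc k' + j \<le> n"
    proof (rule ccontr)
      assume "\<not> ?thesis"
      then have "\<forall>i. Suc k' + i \<le> n \<longrightarrow> M - c (Suc k' + i) = \<alpha> i" using j(1) by auto
      then show False using nb k k' unfolding bad_def by auto
    qed
    have jk: "k < Suc k' + j"
    proof (rule ccontr)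
      assume "\<not> ?thesis"
      then show False using k' j(2) unfolding bad_def by auto
    qed
    \<comment> \<open>The two matches overlap: \<open>s\<close> is the offset of \<open>k\<close> in
      the match from \<open>k'\<close>, and \<open>l\<close> is the offset of the break in the match
      from \<open>k\<close>. Comparing them there makes the tail of \<open>\<alpha>\<close> behind
      \<open>s\<close> larger than \<open>\<alpha>\<close>.\<close>
    define s where "s = k - Suc k'"
    define l where "l = j - Suc s"
    have s: "k = Suc k' + s" using \<open>k' < k\<close> by (simp add: s_def)
    have l: "j = Suc s + l" using jk s by (simp add: l_def)
    have eq: "M - c (Suc k + i) = \<alpha> i" if "i \<le> l" for i
      using k jn that s l unfolding bad_def by auto
    have "\<alpha> \<sqsubset> tail_seq (Suc s) \<alpha>"
      unfolding lex_less_def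
    proof (intro exI[of _ l] conjI allI impI)
      show "\<alpha> l < tail_seq (Suc s) \<alpha> l"
        using eq[of l] j(2) s l by (simp add: tail_seq_def add.assoc)
      fix i assume "i < l"
      then show "\<alpha> i = tail_seq (Suc s) \<alpha> i"
        using eq[of i] j(1)[rule_format, of "Suc s + i"] s l by (simp add: tail_seq_def add.assoc)
    qed
    moreover have "\<alpha> s = M - c k" using k' s unfolding bad_def by auto
    then have "\<alpha> s < M" using k M_pos unfolding bad_def by auto
    then have "tail_seq (Suc s) \<alpha> \<sqsubseteq> \<alpha>" by (rule alpha_tail)
    ultimately show False using lex_not_less by blast
  qed
  then have "good c k" using goodI k unfolding bad_def by blast
  then show thesis using that k unfolding bad_def by blast
qed

lemma infinitely_many_good:
  assumes c: "c \<in> digit_seqs M" "\<And>k. 0 < c k \<Longrightarrow> mirror M (tail_seq (Suc k) c) \<sqsubset> \<alpha>"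
    and inf: "\<And>N. \<exists>n\<ge>N. 0 < c n"
  obtains n where "N \<le> n" "good c n"
proof (rule ccontr)
  assume not: "\<not> thesis"
  then have ng: "\<not> good c n" if "N \<le> n" for n using \<open>\<And>n. N \<le> n \<Longrightarrow> good c n \<Longrightarrow> thesis\<close> that by blast
  have "\<forall>\<^sub>F n in sequentially. \<forall>k\<in>{..<N}. 0 < c k \<longrightarrow> \<not> (\<forall>i. Suc k + i \<le> n \<longrightarrow> M - c (Suc k + i) = \<alpha> i)"
  proof (intro eventually_ball_finite ballI)
    fix k
    show "\<forall>\<^sub>F n in sequentially. 0 < c k \<longrightarrow> \<not> (\<forall>i. Suc k + i \<le> n \<longrightarrow> M - c (Suc k + i) = \<alpha> i)"
    proof (cases "0 < c k")
      case True
      then obtain l where "M - c (Suc k + l) < \<alpha> l"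
        using c(2) unfolding lex_less_def mirror_def tail_seq_def by blast
      then show ?thesis unfolding eventually_sequentially
        by (intro exI[of _ "Suc k + l"]) (auto intro!: exI[of _ l])
    qed simp
  qed simp
  \<comment> \<open>Each of the finitely many \<open>k < N\<close> obstructs only finitely many
    positions, since its strict inequality is decided at some index; behind \<open>N'\<close> none
    of them obstructs.\<close>
  then obtain N' where N': "\<And>n k. N' \<le> n \<Longrightarrow> k < N \<Longrightarrow> 0 < c k \<Longrightarrow> \<not> (\<forall>i. Suc k + i \<le> n \<longrightarrow> M - c (Suc k + i) = \<alpha> i)"
    unfolding eventually_sequentially by blast
  obtain n where n: "max N N' \<le> n" "0 < c n" using inf by blast
  then have "\<not> good c n" using ng by simp
  then obtain k where k: "k < n" "good c k" "\<forall>i. Suc k + i \<le> n \<longrightarrow> M - c (Suc k + i) = \<alpha> i"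
    using obstruction_good[OF c n(2)] by blast
  have "k < N" using ng[of k] k(2) by (meson leI)
  then show False using N'[of n k] n(1) k unfolding good_def by auto
qed

text \<open>Such a sequence is \<open>(\<alpha>\<^sub>0 \<dots> \<alpha>\<^sub>n)\<close> alternating with its reflection. Its tails and
  reflected tails are bounded by \<open>a\<close> itself, so \<open>a \<sqsubset> \<alpha>\<close> turns weak inequalities into strict ones.\<close>

lemma antiperiodic_U_seqs:
  assumes n: "good \<alpha> n" and a: "a \<in> digit_seqs M" "\<And>i. i \<le> n \<Longrightarrow> a i = \<alpha> i"
    "\<And>i. a (Suc n + i) = M - a i"
    and w: "w \<le> n" "\<forall>i<w. M - \<alpha> i = \<alpha> i" "M - \<alpha> w < \<alpha> w"
  shows "a \<in> U_seqs" "a \<sqsubset> \<alpha>"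
proof -
  have dig: "\<alpha> i \<le> M" "a i \<le> M" for i using alpha_digits a(1) by (auto simp: digit_seqs_iff)
  have an: "0 < \<alpha> n" using n by (simp add: good_def)
  have period: "tail_seq (Suc n) a = mirror M a" using a(3) by (auto simp: tail_seq_def mirror_def)
  show less: "a \<sqsubset> \<alpha>"
  proof (rule ccontr)
    assume "\<not> ?thesis"
    then consider "a = \<alpha>" | "\<alpha> \<sqsubset> a" using lex_linear[of a \<alpha>] by auto
    then show False
    proof cases
      case 1
      then show False
        using alpha_mirror[OF an] period mirror_mirror[OF alpha_digits] lex_irrefl by metis
    next
      case 2
      then obtain i where i: "\<forall>j<i. \<alpha> j = a j" "\<alpha> i < a i" unfolding lex_less_def by blast
      \<comment> \<open>Up to \<open>n\<close> the two sequences agree, so the excess occurs in a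
        later block; reflecting it back puts \<open>\<alpha>\<close> below its own reflected
        tail.\<close>
      have "n < i" using i(2) a(2)[of i] by (metis leI less_irrefl)
      then obtain x where x: "i = Suc n + x" by (metis less_natE add_Suc_right add_Suc)
      have "\<alpha> \<sqsubset> mirror M (tail_seq (Suc n) \<alpha>)"
        unfolding lex_less_def mirror_def tail_seq_def
      proof (intro exI[of _ x] conjI allI impI)
        show "\<alpha> x < M - \<alpha> (Suc n + x)" using i a(3)[of x] x dig(2)[of x] by auto
        fix y assume "y < x"
        then have "\<alpha> (Suc n + y) = a (Suc n + y)" "\<alpha> y = a y" using i(1) x by auto
        then show "\<alpha> y = M - \<alpha> (Suc n + y)" using a(3)[of y] dig(2)[of y] by simp
      qed
      then show False using alpha_mirror[OF an] lex_trans lex_irrefl by blast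
    qed
  qed
  define P where "P j \<longleftrightarrow> (a j < M \<longrightarrow> tail_seq (Suc j) a \<sqsubseteq> a)
    \<and> (0 < a j \<longrightarrow> mirror M (tail_seq (Suc j) a) \<sqsubseteq> a)" for j
  have low: "P j" if j: "j < n" for j
  proof -
    have aj: "a j = \<alpha> j" using a(2) j by simp
    have "tail_seq (Suc j) a \<sqsubset> a" if lt: "\<alpha> j < M"
    proof (cases "\<forall>i. Suc j + i \<le> n \<longrightarrow> \<alpha> (Suc j + i) = \<alpha> i")
      case False
      define i where "i = (LEAST i. \<alpha> (Suc j + i) \<noteq> \<alpha> i)"
      have ex: "\<exists>i. \<alpha> (Suc j + i) \<noteq> \<alpha> i" using False by blast
      have i: "\<alpha> (Suc j + i) \<noteq> \<alpha> i" unfolding i_def by (rule LeastI_ex[OF ex])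
      have below: "\<alpha> (Suc j + i') = \<alpha> i'" if "i' < i" for i'
        using not_less_Least[of i' "\<lambda>i. \<alpha> (Suc j + i) \<noteq> \<alpha> i"] that unfolding i_def by blast
      have "Suc j + i \<le> n"
      proof (rule ccontr)
        assume "\<not> ?thesis"
        then show False using False below by auto
      qed
      moreover have "\<alpha> (Suc j + i) < \<alpha> i"
      proof (rule ccontr)
        assume "\<not> ?thesis"
        then have "\<alpha> \<sqsubset> tail_seq (Suc j) \<alpha>" using i below
          unfolding lex_less_def tail_seq_def by (intro exI[of _ i]) auto
        then show False using alpha_tail[OF lt] lex_not_less by blast
      qed
      ultimately show ?thesis
        unfolding lex_less_def tail_seq_def using below a(2) by (intro exI[of _ i]) auto
    next
      case True
      \<comment> \<open>The block behind \<open>j\<close> repeats \<open>\<alpha>\<close> up to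
        index \<open>k\<close>, and then the reflected block begins. Goodness of \<open>n\<close>
        applied at \<open>k\<close> makes this reflected block smaller than the continuation of
        \<open>\<alpha>\<close>.\<close>
      define k where "k = n - Suc j"
      have k: "n = Suc j + k" "k < n" using j by (auto simp: k_def)
      have "\<alpha> k = \<alpha> n" using True k(1) by simp
      then have ak: "0 < \<alpha> k" using an by simp
      obtain l where l: "Suc k + l \<le> n" "M - \<alpha> (Suc k + l) < \<alpha> l" "\<forall>i<l. M - \<alpha> (Suc k + i) = \<alpha> i"
        using good_witness[OF n k(2) ak alpha_mirror[OF ak]] by blast
      have val: "tail_seq (Suc j) a (Suc k + i) = M - \<alpha> i" "a (Suc k + i) = \<alpha> (Suc k + i)" if "i \<le> l" for i
      proof -
        have "Suc j + (Suc k + i) = Suc n + i" using k by simp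
        then have "tail_seq (Suc j) a (Suc k + i) = M - a i" unfolding tail_seq_def using a(3)[of i] by metis
        then show "tail_seq (Suc j) a (Suc k + i) = M - \<alpha> i" using a(2)[of i] that l(1) by simp
        show "a (Suc k + i) = \<alpha> (Suc k + i)" using a(2) that l(1) by simp
      qed
      show ?thesis unfolding lex_less_def
      proof (intro exI[of _ "Suc k + l"] conjI allI impI)
        show "tail_seq (Suc j) a (Suc k + l) < a (Suc k + l)"
          using val[of l] l(2) dig(1)[of l] dig(1)[of "Suc k + l"] by linarith
        fix i assume i: "i < Suc k + l"
        show "tail_seq (Suc j) a i = a i"
        proof (cases "i \<le> k")
          case True': True
          then show ?thesis using True[rule_format, of i] a(2) k by (simp add: tail_seq_def)
        next
          case False
          then obtain x where x: "i = Suc k + x" by (metis not_less_eq_eq le_Suc_ex)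
          then show ?thesis
            using i val[of x] l(3)[rule_format, of x] dig(1)[of "Suc k + x"] dig(1)[of x] by auto
        qed
      qed
    qed
    moreover have "mirror M (tail_seq (Suc j) a) \<sqsubset> a" if pos: "0 < \<alpha> j"
    proof -
      obtain l where "Suc j + l \<le> n" "M - \<alpha> (Suc j + l) < \<alpha> l" "\<forall>i<l. M - \<alpha> (Suc j + i) = \<alpha> i"
        using good_witness[OF n j pos alpha_mirror[OF pos]] by blast
      then show ?thesis
        unfolding lex_less_def mirror_def tail_seq_def using a(2) by (intro exI[of _ l]) auto
    qed
    ultimately show ?thesis unfolding P_def aj using lex_less_imp_le by blast
  qed
  have mid: "P n"
  proof -
    \<comment> \<open>The index \<open>w\<close> where \<open>\<alpha>\<close> beats its reflection
      lies in the first block, so \<open>a\<close> beats its reflection there too.\<close>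
    have "mirror M a \<sqsubset> a"
      unfolding lex_less_def mirror_def using w a(2) by (intro exI[of _ w]) auto
    then show ?thesis
      unfolding P_def period using lex_less_imp_le mirror_mirror[OF a(1)] by auto
  qed
  \<comment> \<open>Behind position \<open>n\<close> each tail is the reflection of the tail one
    block earlier, and reflection only swaps the two halves of \<open>P\<close>.\<close>
  have "P j" for j
  proof (induction j rule: less_induct)
    case (less j)
    show ?case
    proof (cases "j \<le> n")
      case True
      then show ?thesis using low mid by (cases "j = n") auto
    next
      case False
      then obtain x where x: "j = Suc n + x" by (metis not_less_eq_eq le_Suc_ex)
      have aj: "a j = M - a x" using a(3) x by simp
      have "tail_seq (Suc j) a = tail_seq (Suc x) (tail_seq (Suc n) a)"
        using x by (simp add: tail_seq_tail_seq)
      then have t: "tail_seq (Suc j) a = mirror M (tail_seq (Suc x) a)"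
        using period by (simp add: tail_seq_mirror)
      have "P x" using less x by simp
      then show ?thesis
        unfolding P_def t aj mirror_mirror[OF tail_seq_in_digit_seqs[OF a(1)]] by auto
    qed
  qed
  then show "a \<in> U_seqs"
    unfolding U_seqs_iff P_def using a(1) less lex_le_less_trans by blast
qed

text \<open>The block ends at a good position beyond \<open>N\<close> and beyond the index where
  \<open>\<alpha>\<close> and its reflection part.\<close>

lemma alpha_approximation:
  obtains a where "a \<in> U_seqs" "a \<sqsubset> \<alpha>" "\<forall>i<N. a i = \<alpha> i"
proof -
  obtain w where w: "\<forall>i<w. M - \<alpha> i = \<alpha> i" "M - \<alpha> w < \<alpha> w"
    using alpha_mirror_less unfolding lex_less_def mirror_def by blast
  obtain n where n: "max w N \<le> n" "good \<alpha> n"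
    using infinitely_many_good[OF alpha_digits alpha_mirror alpha_infinite] by blast
  define a where "a i = (if even (i div Suc n) then \<alpha> (i mod Suc n) else M - \<alpha> (i mod Suc n))" for i
  have D: "a \<in> digit_seqs M" using alpha_digits by (auto simp: digit_seqs_iff a_def)
  have pre: "a i = \<alpha> i" if "i \<le> n" for i using that by (simp add: a_def)
  have "a (Suc n + i) = M - a i" for i
  proof -
    have "(Suc n + i) div Suc n = Suc (i div Suc n)" "(Suc n + i) mod Suc n = i mod Suc n"
      using div_add_self1[of "Suc n" i] mod_add_self1[of "Suc n" i] by simp_all
    then show ?thesis using alpha_digits unfolding a_def digit_seqs_iff by simp
  qed
  then have "a \<in> U_seqs" "a \<sqsubset> \<alpha>"
    using antiperiodic_U_seqs[OF n(2) D pre _ _ w] n(1) by auto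
  then show thesis using that pre n(1) by simp
qed

section \<open>Approximating \<open>V_seqs\<close> by \<open>U_seqs\<close>, and
  \<open>U_seqs\<close> by the rest of \<open>V_seqs\<close>\<close>

text \<open>Whichever tail starts later is a tail of the earlier one, so a reflected tail of
  \<open>\<alpha>\<close> behind a positive digit would equal \<open>\<alpha>\<close>. At equal
  positions \<open>\<alpha>\<close> would be its own reflection.\<close>

lemma not_both_tails:
  assumes "c \<in> digit_seqs M" "c k < M" "tail_seq (Suc k) c = \<alpha>"
    and "0 < c j" "mirror M (tail_seq (Suc j) c) = \<alpha>"
  shows False
proof -
  consider "j = k" | "k < j" | "j < k" by linarith
  then show False
  proof cases
    case 1
    then show False using assms(3,5) alpha_mirror_less lex_irrefl by metis
  next
    case 2
    then obtain x where x: "j = Suc k + x" by (metis less_natE add_Suc_right add_Suc)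
    have "0 < \<alpha> x" using assms(3,4) x unfolding tail_seq_def by (metis)
    moreover have "mirror M (tail_seq (Suc x) \<alpha>) = \<alpha>"
      using assms(5) x unfolding assms(3)[symmetric] tail_seq_tail_seq by simp
    ultimately show False using alpha_mirror lex_irrefl by metis
  next
    case 3
    then obtain x where x: "k = Suc j + x" by (metis less_natE add_Suc_right add_Suc)
    have "\<alpha> x = M - c k" using assms(5) x unfolding tail_seq_def mirror_def by metis
    then have "0 < \<alpha> x" using assms(2) by simp
    moreover have "mirror M (tail_seq (Suc x) \<alpha>) = \<alpha>"
    proof -
      have "tail_seq (Suc x) \<alpha> = mirror M (tail_seq (Suc k) c)"
        using x unfolding assms(5)[symmetric] tail_seq_mirror tail_seq_tail_seq by simp
      then show ?thesis using assms(3) mirror_mirror[OF alpha_digits] by simp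
    qed
    ultimately show False using alpha_mirror lex_irrefl by metis
  qed
qed

lemma V_seqs_not_U_seqs:
  assumes "c \<in> V_seqs" "c \<notin> U_seqs"
  obtains k where "c k < M" "tail_seq (Suc k) c = \<alpha>"
  | k where "mirror M c k < M" "tail_seq (Suc k) (mirror M c) = \<alpha>"
  using assms unfolding V_seqs_iff U_seqs_iff lex_le_def mirror_less_iff tail_seq_mirror by blast

text \<open>The tail \<open>\<alpha>\<close> is replaced by a smaller member of
  \<open>U_seqs\<close> that agrees with it for long. This makes the direct inequalities up to
  \<open>k\<close> strict; the reflected ones are strict already by \<open>not_both_tails\<close>
  and survive because finitely many digits decide them.\<close>

lemma U_seqs_approximates_tail:
  assumes c: "c \<in> V_seqs" and k: "c k < M" "tail_seq (Suc k) c = \<alpha>"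
  shows "\<exists>d\<in>U_seqs. \<forall>i<N. d i = c i"
proof -
  have D: "c \<in> digit_seqs M" using c by (simp add: V_seqs_def)
  have "\<forall>\<^sub>F n in sequentially. \<forall>j\<in>{..k}. \<forall>a. 0 < c j \<longrightarrow> (\<forall>i<n. a i = \<alpha> i) \<longrightarrow>
      mirror M (tail_seq (Suc j) (append_seq (Suc k) c a)) \<sqsubset> \<alpha>"
  proof (intro eventually_ball_finite ballI)
    fix j assume j: "j \<in> {..k}"
    show "\<forall>\<^sub>F n in sequentially. \<forall>a. 0 < c j \<longrightarrow> (\<forall>i<n. a i = \<alpha> i) \<longrightarrow>
      mirror M (tail_seq (Suc j) (append_seq (Suc k) c a)) \<sqsubset> \<alpha>"
    proof (cases "0 < c j")
      case True
      have "mirror M (tail_seq (Suc j) c) \<sqsubset> \<alpha>"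
        using c True not_both_tails[OF D k True] unfolding V_seqs_iff lex_le_def by blast
      then obtain m where m: "\<And>e f. (\<forall>i<m. e i = mirror M (tail_seq (Suc j) c) i) \<Longrightarrow>
          (\<forall>i<m. f i = \<alpha> i) \<Longrightarrow> e \<sqsubset> f"
        using lex_less_open by metis
      have "mirror M (tail_seq (Suc j) (append_seq (Suc k) c a)) \<sqsubset> \<alpha>"
        if n: "Suc j + m \<le> n" "\<forall>i<n. a i = \<alpha> i" for n a
      proof (rule m)
        have "append_seq (Suc k) c a i = c i" if "i < Suc j + m" for i
        proof (cases "i < Suc k")
          case False
          then obtain x where x: "i = Suc k + x" by (metis not_less le_Suc_ex)
          have "a x = \<alpha> x" using n x \<open>i < Suc j + m\<close> by simp
          then show ?thesis using x k(2) by (auto simp: append_seq_def tail_seq_def)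
        qed (simp add: append_seq_def)
        then show "\<forall>i<m. mirror M (tail_seq (Suc j) (append_seq (Suc k) c a)) i
            = mirror M (tail_seq (Suc j) c) i"
          by (simp add: mirror_def tail_seq_def)
      qed simp
      then show ?thesis unfolding eventually_sequentially by blast
    qed simp
  qed simp
  \<comment> \<open>Only the finitely many \<open>j \<le> k\<close> matter, so one agreement length
    serves them all.\<close>
  then obtain n where n: "\<And>j a. j \<le> k \<Longrightarrow> 0 < c j \<Longrightarrow> (\<forall>i<n. a i = \<alpha> i) \<Longrightarrow>
      mirror M (tail_seq (Suc j) (append_seq (Suc k) c a)) \<sqsubset> \<alpha>"
    unfolding eventually_sequentially by (meson atMost_iff order_refl)
  obtain a where a: "a \<in> U_seqs" "a \<sqsubset> \<alpha>" "\<forall>i<max n N. a i = \<alpha> i" using alpha_approximation by blast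
  have aD: "a \<in> digit_seqs M" using a(1) by (simp add: U_seqs_def)
  let ?d = "append_seq (Suc k) c a"
  have "?d \<in> U_seqs"
    unfolding U_seqs_iff
  proof (intro conjI allI)
    show "?d \<in> digit_seqs M" by (rule append_seq_in_digit_seqs[OF D aD])
    fix j
    have low: "tail_seq (Suc j) ?d \<sqsubset> \<alpha>" if "j \<le> k" "c j < M"
    proof -
      have "tail_seq (Suc j) ?d = append_seq (k - j) (tail_seq (Suc j) c) a"
        using that(1) by (simp add: tail_append_seq_le)
      moreover have "append_seq (k - j) (tail_seq (Suc j) c) \<alpha> = tail_seq (Suc j) c"
        using append_tail_seq[of "k - j" "tail_seq (Suc j) c"] k(2) that(1) by (simp add: tail_seq_tail_seq)
      ultimately have "tail_seq (Suc j) ?d \<sqsubset> tail_seq (Suc j) c"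
        using a(2) lex_less_append_iff by metis
      also have "tail_seq (Suc j) c \<sqsubseteq> \<alpha>" using c that(2) by (simp add: V_seqs_iff)
      finally (lex_less_le_trans) show ?thesis .
    qed
    show "?d j < M \<longrightarrow> tail_seq (Suc j) ?d \<sqsubset> \<alpha>"
    proof (cases "j \<le> k")
      case True
      then show ?thesis using low by (simp add: append_seq_def)
    next
      case False
      then obtain x where x: "j = Suc k + x" by (metis not_less_eq_eq le_Suc_ex)
      show ?thesis using a(1) unfolding x append_seq_add tail_append_seq_add U_seqs_iff by blast
    qed
    show "0 < ?d j \<longrightarrow> mirror M (tail_seq (Suc j) ?d) \<sqsubset> \<alpha>"
    proof (cases "j \<le> k")
      case True
      then show ?thesis using n[of j a] a(3) by (simp add: append_seq_def)
    next
      case False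
      then obtain x where x: "j = Suc k + x" by (metis not_less_eq_eq le_Suc_ex)
      show ?thesis using a(1) unfolding x append_seq_add tail_append_seq_add U_seqs_iff by blast
    qed
  qed
  moreover have "\<forall>i<N. ?d i = c i"
  proof (intro allI impI)
    fix i assume i: "i < N"
    show "?d i = c i"
    proof (cases "i < Suc k")
      case False
      then obtain x where x: "i = Suc k + x" by (metis not_less le_Suc_ex)
      then have "a x = \<alpha> x" using a(3) i by simp
      then show ?thesis using x k(2) by (auto simp: append_seq_def tail_seq_def)
    qed (simp add: append_seq_def)
  qed
  ultimately show ?thesis by blast
qed

lemma U_seqs_approximates_V_seqs:
  assumes c: "c \<in> V_seqs"
  shows "\<exists>d\<in>U_seqs. \<forall>i<N. d i = c i"
proof (cases "c \<in> U_seqs")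
  case False
  from c False show ?thesis
  proof (cases rule: V_seqs_not_U_seqs)
    case (1 k)
    then show ?thesis using U_seqs_approximates_tail[OF c] by blast
  next
    case (2 k)
    then obtain d where d: "d \<in> U_seqs" "\<forall>i<N. d i = mirror M c i"
      using U_seqs_approximates_tail[OF mirror_in_V_seqs[OF c]] by blast
    have "c \<in> digit_seqs M" using c by (simp add: V_seqs_def)
    then have "\<forall>i<N. mirror M d i = c i" using d(2) by (auto simp: mirror_def digit_seqs_iff)
    then show ?thesis using mirror_in_U_seqs[OF d(1)] by blast
  qed
qed auto

text \<open>A tail \<open>\<alpha>\<close> behind a digit below \<open>M\<close> keeps a sequence
  out of \<open>U_seqs\<close>, so one is planted far out. For a nonzero \<open>c\<close> it goes
  behind a lowered digit at a good position; the zero sequence has no such digit and gets the tail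
  \<open>\<alpha>\<close> directly.\<close>

lemma V_seqs_minus_U_seqs_approximates_U_seqs:
  assumes c: "c \<in> U_seqs"
  shows "\<exists>d\<in>V_seqs - U_seqs. \<forall>i<N. d i = c i"
proof (cases "\<forall>i. c i = 0")
  case True
  let ?d = "append_seq (Suc N) (\<lambda>_. 0) \<alpha>"
  have "?d \<in> V_seqs"
    unfolding V_seqs_iff
  proof (intro conjI allI)
    show "?d \<in> digit_seqs M" by (rule append_seq_in_digit_seqs[OF _ alpha_digits]) (simp add: digit_seqs_iff)
    fix j
    show "?d j < M \<longrightarrow> tail_seq (Suc j) ?d \<sqsubseteq> \<alpha>"
    proof (cases "j \<le> N")
      case True
      show ?thesis
      proof (cases "j = N")
        case True
        then show ?thesis by (simp add: tail_append_seq)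
      next
        case False
        then have "tail_seq (Suc j) ?d 0 = 0" using \<open>j \<le> N\<close> by (simp add: tail_seq_def append_seq_def)
        then have "tail_seq (Suc j) ?d \<sqsubset> \<alpha>" using alpha_0_pos unfolding lex_less_def by (intro exI[of _ 0]) auto
        then show ?thesis using lex_less_imp_le by blast
      qed
    next
      case False
      then obtain x where x: "j = Suc N + x" by (metis not_less_eq_eq le_Suc_ex)
      show ?thesis using alpha_tail unfolding x append_seq_add tail_append_seq_add by blast
    qed
    show "0 < ?d j \<longrightarrow> mirror M (tail_seq (Suc j) ?d) \<sqsubseteq> \<alpha>"
    proof (cases "j \<le> N")
      case True
      then show ?thesis by (simp add: append_seq_def)
    next
      case False
      then obtain x where x: "j = Suc N + x" by (metis not_less_eq_eq le_Suc_ex)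
      show ?thesis
        using alpha_mirror lex_less_imp_le unfolding x append_seq_add tail_append_seq_add by blast
    qed
  qed
  moreover have "?d \<notin> U_seqs"
  proof
    assume "?d \<in> U_seqs"
    moreover have "?d N < M" using M_pos by (simp add: append_seq_def)
    ultimately have "tail_seq (Suc N) ?d \<sqsubset> \<alpha>" by (simp add: U_seqs_iff)
    then show False by (simp add: tail_append_seq lex_irrefl)
  qed
  moreover have "\<forall>i<N. ?d i = c i" using True by (simp add: append_seq_def)
  ultimately show ?thesis by blast
next
  case False
  have D: "c \<in> digit_seqs M" using c by (simp add: U_seqs_def)
  have mir: "mirror M (tail_seq (Suc k) c) \<sqsubset> \<alpha>" if "0 < c k" for k
    using c that by (simp add: U_seqs_iff)
  have "infinite_seq c"
    unfolding infinite_seq_def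
  proof
    assume "finite_seq c"
    then obtain n where n: "c n \<noteq> 0" "\<forall>k>n. c k = 0" unfolding finite_seq_def by blast
    have "mirror M (tail_seq (Suc n) c) = (\<lambda>_. M)" using n(2) by (auto simp: mirror_def tail_seq_def)
    then show False using mir[of n] n(1) lex_le_const_max[OF alpha_digits] lex_not_less by auto
  qed
  then have "\<exists>n\<ge>k. 0 < c n" for k using False by (auto simp: infinite_seq_iff)
  then obtain n where n: "N \<le> n" "good c n" using infinitely_many_good[OF D mir] by blast
  have cn: "0 < c n" using n(2) by (simp add: good_def)
  let ?d = "append_seq (Suc n) (c(n := c n - 1)) \<alpha>"
  have d_less: "?d i = c i" if "i < n" for i using that by (simp add: append_seq_def)
  have d_n: "?d n = c n - 1" by (simp add: append_seq_def)
  have d_n_less: "?d n < M" using d_n cn D by (metis One_nat_def diff_less digit_seqs_iff less_le_trans zero_less_one)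
  have t_n: "tail_seq (Suc n) ?d = \<alpha>" by (rule tail_append_seq)
  have "?d \<in> V_seqs"
    unfolding V_seqs_iff
  proof (intro conjI allI)
    have "c(n := c n - 1) \<in> digit_seqs M" using D by (auto simp: digit_seqs_iff intro: le_trans[OF diff_le_self])
    then show "?d \<in> digit_seqs M" by (rule append_seq_in_digit_seqs[OF _ alpha_digits])
    fix j
    consider "j < n" | "j = n" | "n < j" by linarith
    then have "(?d j < M \<longrightarrow> tail_seq (Suc j) ?d \<sqsubseteq> \<alpha>) \<and> (0 < ?d j \<longrightarrow> mirror M (tail_seq (Suc j) ?d) \<sqsubseteq> \<alpha>)"
    proof cases
      case 1
      obtain x where x: "n = Suc j + x" using 1 by (metis less_natE add_Suc_right add_Suc)
      have "tail_seq (Suc j) ?d \<sqsubset> tail_seq (Suc j) c"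
        unfolding lex_less_def tail_seq_def
        by (rule exI[of _ x]) (use d_less d_n cn x in auto)
      moreover have "tail_seq (Suc j) c \<sqsubset> \<alpha>" if "c j < M" using c that by (simp add: U_seqs_iff)
      moreover have "mirror M (tail_seq (Suc j) ?d) \<sqsubset> \<alpha>" if pos: "0 < c j"
      proof -
        obtain l where l: "Suc j + l \<le> n" "M - c (Suc j + l) < \<alpha> l" "\<forall>i<l. M - c (Suc j + i) = \<alpha> i"
          using good_witness[OF n(2) 1 pos mir[OF pos]] by blast
        have below: "mirror M (tail_seq (Suc j) ?d) i = \<alpha> i" if "i < l" for i
          using l(1,3) that d_less[of "Suc j + i"] by (simp add: mirror_def tail_seq_def)
        show ?thesis
        proof (cases "mirror M (tail_seq (Suc j) ?d) l < \<alpha> l")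
          case True
          then show ?thesis using below unfolding lex_less_def by blast
        next
          case False
          \<comment> \<open>Lowering digit \<open>n\<close> raises the reflected digit by one, so a
            strict inequality decided exactly at \<open>n\<close> may become an equality. Then the
            reflection of \<open>\<alpha>\<close> follows, which \<open>alpha_mirror\<close> places
            below the continuation of \<open>\<alpha>\<close>.\<close>
          have ln: "Suc j + l = n"
          proof (rule ccontr)
            assume "\<not> ?thesis"
            then show False using False l(1,2) d_less[of "Suc j + l"] by (simp add: mirror_def tail_seq_def)
          qed
          have "c n \<le> M" using D by (simp add: digit_seqs_iff)
          then have at_l: "mirror M (tail_seq (Suc j) ?d) l = \<alpha> l"
            using False l(2) d_n cn ln by (simp add: mirror_def tail_seq_def)
          have "tail_seq (Suc l) (mirror M (tail_seq (Suc j) ?d)) = mirror M (tail_seq (Suc n) ?d)"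
            using ln by (simp add: tail_seq_mirror tail_seq_tail_seq flip: ln)
          then have "mirror M (tail_seq (Suc j) ?d) = append_seq (Suc l) (mirror M (tail_seq (Suc j) ?d)) (mirror M \<alpha>)"
            using append_tail_seq t_n by metis
          also have "\<dots> = append_seq (Suc l) \<alpha> (mirror M \<alpha>)"
            using below at_l by (auto simp: append_seq_def less_Suc_eq)
          finally have "mirror M (tail_seq (Suc j) ?d) = append_seq (Suc l) \<alpha> (mirror M \<alpha>)" .
          moreover have "0 < \<alpha> l" using l(2) by simp
          then have "mirror M \<alpha> \<sqsubset> tail_seq (Suc l) \<alpha>"
            using lex_less_mirror[OF mirror_in_digit_seqs alpha_digits alpha_mirror]
              mirror_mirror[OF tail_seq_in_digit_seqs[OF alpha_digits]] by metis
          then have "append_seq (Suc l) \<alpha> (mirror M \<alpha>) \<sqsubset> append_seq (Suc l) \<alpha> (tail_seq (Suc l) \<alpha>)"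
            by (simp add: lex_less_append_iff)
          ultimately show ?thesis by (simp add: append_tail_seq)
        qed
      qed
      ultimately show ?thesis using d_less[OF 1] lex_trans lex_less_imp_le by metis
    next
      case 2
      then show ?thesis using t_n alpha_mirror_less lex_less_imp_le by simp
    next
      case 3
      then obtain x where x: "j = Suc n + x" by (metis less_natE add_Suc_right add_Suc)
      show ?thesis
        using alpha_tail alpha_mirror lex_less_imp_le unfolding x append_seq_add tail_append_seq_add by blast
    qed
    then show "?d j < M \<longrightarrow> tail_seq (Suc j) ?d \<sqsubseteq> \<alpha>"
      and "0 < ?d j \<longrightarrow> mirror M (tail_seq (Suc j) ?d) \<sqsubseteq> \<alpha>" by blast+
  qed
  moreover have "?d \<notin> U_seqs"
    using d_n_less t_n lex_irrefl unfolding U_seqs_iff by metis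
  moreover have "\<forall>i<N. ?d i = c i" using d_less n(1) by simp
  ultimately show ?thesis by blast
qed

section \<open>Topology and cardinality of \<open>V_set\<close> and of its part outside
  \<open>U_set\<close>\<close>

text \<open>The weak inequalities defining \<open>V_seqs\<close> pass to a limit of digit sequences:
  each digit is eventually constant, so the side conditions on it hold along the sequence
  too.\<close>

lemma closed_V_set: "closed (V_set M q)"
  unfolding closed_sequential_limits
proof (intro allI impI, elim conjE)
  fix x l assume x: "\<forall>n. x n \<in> V_set M q" and l: "x \<longlonglongrightarrow> l"
  have "\<forall>n. \<exists>c\<in>V_seqs. x n = seq_value q c" using x unfolding V_set_eq by blast
  then obtain f where f: "\<And>n. f n \<in> V_seqs" "\<And>n. x n = seq_value q (f n)" by metis
  have fD: "f n \<in> digit_seqs M" for n using f(1) by (simp add: V_seqs_def)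
  obtain c r where c: "c \<in> digit_seqs M" "strict_mono r"
    "\<And>i. \<forall>\<^sub>F k in sequentially. f (r k) i = c i"
    using digit_seqs_convergent_subsequence[of f M] fD by blast
  have lim_tail: "\<forall>\<^sub>F k in sequentially. tail_seq n (f (r k)) i = tail_seq n c i" for n i
    using c(3)[of "n + i"] by (simp add: tail_seq_def)
  have lim_mirror: "\<forall>\<^sub>F k in sequentially. mirror M (tail_seq n (f (r k))) i = mirror M (tail_seq n c) i" for n i
    using lim_tail[of n i] by eventually_elim (simp add: mirror_def)
  have "c \<in> V_seqs"
    unfolding V_seqs_iff
  proof (intro conjI allI impI c(1))
    fix n
    show "tail_seq (Suc n) c \<sqsubseteq> \<alpha>" if n: "c n < M"
    proof (rule lex_le_limit[OF lim_tail])
      show "\<forall>\<^sub>F k in sequentially. tail_seq (Suc n) (f (r k)) \<sqsubseteq> \<alpha>"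
        using c(3)[of n] by eventually_elim (use f(1) n in \<open>auto simp: V_seqs_iff\<close>)
    qed simp
    show "mirror M (tail_seq (Suc n) c) \<sqsubseteq> \<alpha>" if n: "0 < c n"
    proof (rule lex_le_limit[OF lim_mirror])
      show "\<forall>\<^sub>F k in sequentially. mirror M (tail_seq (Suc n) (f (r k))) \<sqsubseteq> \<alpha>"
        using c(3)[of n] by eventually_elim (use f(1) n in \<open>auto simp: V_seqs_iff\<close>)
    qed simp
  qed
  moreover have "(\<lambda>k. seq_value q (f (r k))) \<longlonglongrightarrow> seq_value q c"
    by (rule seq_value_tendsto[OF tendsto_const q_gt_1, of "\<lambda>k. f (r k)" M]) (use fD c(3) in auto)
  then have "(x \<circ> r) \<longlonglongrightarrow> seq_value q c" by (simp add: comp_def f(2))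
  then have "l = seq_value q c"
    using LIMSEQ_subseq_LIMSEQ[OF l c(2)] LIMSEQ_unique by blast
  ultimately show "l \<in> V_set M q" unfolding V_set_eq by blast
qed

lemma U_set_subset_V_set: "U_set M q \<subseteq> V_set M q"
  unfolding U_set_eq V_set_eq using U_seqs_subset_V_seqs by blast

lemma closure_U_set: "closure (U_set M q) = V_set M q"
proof
  show "closure (U_set M q) \<subseteq> V_set M q"
    by (rule closure_minimal[OF U_set_subset_V_set closed_V_set])
  show "V_set M q \<subseteq> closure (U_set M q)"
  proof
    fix x assume "x \<in> V_set M q"
    then obtain c where c: "c \<in> V_seqs" "x = seq_value q c" unfolding V_set_eq by blast
    have "seq_value q c \<in> closure (U_set M q)"
    proof (rule prefix_closure[OF q_gt_1, of c M])
      show "c \<in> digit_seqs M" using c by (simp add: V_seqs_def)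
      show "\<exists>d\<in>digit_seqs M. (\<forall>i<N. d i = c i) \<and> seq_value q d \<in> U_set M q" for N
        using U_seqs_approximates_V_seqs[OF c(1), of N] unfolding U_set_eq U_seqs_def by blast
    qed
    then show "x \<in> closure (U_set M q)" using c(2) by simp
  qed
qed

lemma seq_value_in_U_set_iff:
  assumes "c \<in> digit_seqs M"
  shows "seq_value q c \<in> U_set M q \<longleftrightarrow> c \<in> U_seqs"
proof
  assume "seq_value q c \<in> U_set M q"
  then obtain d where "d \<in> U_seqs" "seq_value q c = seq_value q d" unfolding U_set_eq by blast
  then show "c \<in> U_seqs" using U_seqs_unique[OF _ assms] by simp
qed (simp add: U_set_eq)

lemma V_minus_U_dense: "V_set M q \<subseteq> closure (V_set M q - U_set M q)"
proof
  fix x assume x: "x \<in> V_set M q"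
  show "x \<in> closure (V_set M q - U_set M q)"
  proof (cases "x \<in> U_set M q")
    case False
    then show ?thesis using x by (intro closure_subset[THEN subsetD]) simp
  next
    case True
    then obtain c where c: "c \<in> U_seqs" "x = seq_value q c" unfolding U_set_eq by blast
    have "seq_value q c \<in> closure (V_set M q - U_set M q)"
    proof (rule prefix_closure[OF q_gt_1, of c M])
      show "c \<in> digit_seqs M" using c by (simp add: U_seqs_def)
      fix N
      obtain d where d: "d \<in> V_seqs - U_seqs" "\<forall>i<N. d i = c i" using V_seqs_minus_U_seqs_approximates_U_seqs[OF c(1)] by blast
      then have "d \<in> digit_seqs M" "d \<notin> U_seqs" by (auto simp: V_seqs_def)
      then show "\<exists>d\<in>digit_seqs M. (\<forall>i<N. d i = c i) \<and> seq_value q d \<in> V_set M q - U_set M q"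
        using d seq_value_in_U_set_iff[of d] unfolding V_set_eq by blast
    qed
    then show ?thesis using c(2) by simp
  qed
qed

text \<open>Up to reflection only sequences with a tail \<open>\<alpha>\<close> have to be treated
  in the counting below.\<close>

lemma V_minus_U_cases:
  assumes "x \<in> V_set M q - U_set M q"
  obtains c k where "c \<in> V_seqs" "c k < M" "tail_seq (Suc k) c = \<alpha>" "x = seq_value q c"
  | c k where "c \<in> V_seqs" "c k < M" "tail_seq (Suc k) c = \<alpha>" "x = seq_value q (mirror M c)"
proof -
  obtain c where c: "c \<in> V_seqs" "x = seq_value q c" using assms unfolding V_set_eq by blast
  have D: "c \<in> digit_seqs M" using c by (simp add: V_seqs_def)
  have "c \<notin> U_seqs" using assms c(2) seq_value_in_U_set_iff[OF D] by simp
  with c(1) show thesis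
  proof (cases rule: V_seqs_not_U_seqs)
    case (1 k)
    then show thesis using that(1) c by blast
  next
    case (2 k)
    then show thesis using that(2)[OF mirror_in_V_seqs[OF c(1)]] c mirror_mirror[OF D] by simp
  qed
qed

text \<open>A finite set is closed, so by density it would be all of \<open>V_set M q\<close>, but 0
  lies in \<open>U_set M q\<close>.\<close>

lemma infinite_V_minus_U: "infinite (V_set M q - U_set M q)"
proof
  assume "finite (V_set M q - U_set M q)"
  then have "closure (V_set M q - U_set M q) = V_set M q - U_set M q"
    by (simp add: finite_imp_closed)
  then have "V_set M q \<inter> U_set M q = {}" using V_minus_U_dense by blast
  moreover have "(\<lambda>_. 0) \<in> U_seqs"
    unfolding U_seqs_iff
  proof (intro conjI allI impI)
    show "tail_seq (Suc n) (\<lambda>_. 0) \<sqsubset> \<alpha>" for n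
      unfolding lex_less_def tail_seq_def using alpha_0_pos by (intro exI[of _ 0]) simp
  qed (auto simp: digit_seqs_iff)
  ultimately show False using U_set_subset_V_set unfolding U_set_eq by blast
qed

text \<open>Each point is given, up to reflection, by a finite word followed by
  \<open>\<alpha>\<close>, and there are countably many words.\<close>

lemma countable_V_minus_U: "countable (V_set M q - U_set M q)"
proof -
  define app where "app xs = append_seq (length xs) (\<lambda>i. xs ! i) \<alpha>" for xs :: "nat list"
  have *: "\<exists>xs. c = app xs" if t: "tail_seq (Suc k) c = \<alpha>" for c k
  proof
    show "c = app (map c [0..<Suc k])"
      using append_tail_seq[of "Suc k" c] t unfolding app_def
      by (metis (no_types, lifting) add.left_neutral append_seq_def diff_zero ext length_map length_upt nth_map_upt)
  qed
  have "V_set M q - U_set M q \<subseteq> range (\<lambda>xs. seq_value q (app xs)) \<union> range (\<lambda>xs. seq_value q (mirror M (app xs)))"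
  proof
    fix x assume "x \<in> V_set M q - U_set M q"
    then show "x \<in> range (\<lambda>xs. seq_value q (app xs)) \<union> range (\<lambda>xs. seq_value q (mirror M (app xs)))"
      by (cases rule: V_minus_U_cases) (use * in blast)+
  qed
  then show ?thesis by (rule countable_subset) auto
qed

section \<open>Number of expansions\<close>

text \<open>Larger expansions are carries in front of a tail \<open>\<alpha>\<close>; a smaller one
  would need a reflected tail \<open>\<alpha>\<close>, which \<open>not_both_tails\<close>
  excludes.\<close>

lemma expansions_eq:
  assumes c: "c \<in> V_seqs" and k0: "c k0 < M" "tail_seq (Suc k0) c = \<alpha>"
  shows "expansions M q (seq_value q c) =
    insert c ((\<lambda>k. append_seq (Suc k) (c(k := Suc (c k))) (\<lambda>_. 0)) ` {k. c k < M \<and> tail_seq (Suc k) c = \<alpha>})"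
proof (intro equalityI subsetI)
  have D: "c \<in> digit_seqs M" "quasi c" using c by (auto simp: V_seqs_def)
  {
    fix d assume "d \<in> expansions M q (seq_value q c)"
    then have d: "d \<in> digit_seqs M" "seq_value q d = seq_value q c" by (auto simp: expansions_iff[OF q_gt_1])
    consider "d = c" | "c \<sqsubset> d" | "d \<sqsubset> c" using lex_linear[of c d] by auto
    then show "d \<in> insert c ((\<lambda>k. append_seq (Suc k) (c(k := Suc (c k))) (\<lambda>_. 0)) `
        {k. c k < M \<and> tail_seq (Suc k) c = \<alpha>})"
    proof cases
      case 2
      then show ?thesis using larger_expansion[OF D(2) d] by blast
    next
      case 3
      then show ?thesis using smaller_expansion[OF c d] not_both_tails[OF D(1) k0] by blast
    qed simp
  }
  fix d assume "d \<in> insert c ((\<lambda>k. append_seq (Suc k) (c(k := Suc (c k))) (\<lambda>_. 0)) `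
        {k. c k < M \<and> tail_seq (Suc k) c = \<alpha>})"
  moreover have "(\<lambda>_. 0) \<in> digit_seqs M" "seq_value q (\<lambda>_. 0) = 0" by (simp_all add: digit_seqs_iff seq_value_def)
  ultimately show "d \<in> expansions M q (seq_value q c)"
    using bump_digit(1,2)[OF q_gt_1 D(1), of "\<lambda>_. 0"] D(1) alpha_value
    by (auto simp: expansions_iff[OF q_gt_1])
qed

text \<open>Two such tails at different positions would make \<open>\<alpha>\<close> equal to its
  own tail behind a digit below \<open>M\<close>, so only one carry is possible.\<close>

lemma two_expansions:
  assumes "\<alpha> \<in> U_seqs" and c: "c \<in> V_seqs" "c k < M" "tail_seq (Suc k) c = \<alpha>"
  shows "card (expansions M q (seq_value q c)) = 2"
proof -
  have D: "c \<in> digit_seqs M" using c by (simp add: V_seqs_def)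
  have lt: "\<not> k < k'" if "c k < M" "tail_seq (Suc k) c = \<alpha>" "c k' < M" "tail_seq (Suc k') c = \<alpha>" for k k'
  proof
    assume "k < k'"
    then obtain x where x: "k' = Suc k + x" by (metis less_natE add_Suc_right add_Suc)
    have "\<alpha> x < M" using that(2,3) x unfolding tail_seq_def by metis
    moreover have "tail_seq (Suc x) \<alpha> = \<alpha>"
    proof -
      have "tail_seq (Suc x) (tail_seq (Suc k) c) = tail_seq (Suc k') c" using x by (simp add: tail_seq_tail_seq)
      then show ?thesis using that(2,4) by simp
    qed
    ultimately show False using assms(1) lex_irrefl unfolding U_seqs_iff by metis
  qed
  have K: "{k. c k < M \<and> tail_seq (Suc k) c = \<alpha>} = {k}"
  proof (intro equalityI subsetI)
    fix k' assume "k' \<in> {k. c k < M \<and> tail_seq (Suc k) c = \<alpha>}"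
    then show "k' \<in> {k}" using lt[of k k'] lt[of k' k] c(2,3) by simp
  qed (use c(2,3) in simp)
  have "append_seq (Suc k) (c(k := Suc (c k))) (\<lambda>_. 0) \<noteq> c"
  proof
    assume "append_seq (Suc k) (c(k := Suc (c k))) (\<lambda>_. 0) = c"
    from fun_cong[OF this, of k] show False by (simp add: append_seq_def)
  qed
  then show ?thesis unfolding expansions_eq[OF c] K by simp
qed

text \<open>Outside \<open>U_seqs\<close> the sequence \<open>\<alpha>\<close> is periodic with
  period \<open>Suc p\<close> and \<open>\<alpha> p < M\<close>. One occurrence of the tail
  \<open>\<alpha>\<close> thus repeats forever, and distinct positions give distinct
  carries.\<close>

lemma countably_many_expansions:
  assumes "\<alpha> \<notin> U_seqs" and c: "c \<in> V_seqs" "c k < M" "tail_seq (Suc k) c = \<alpha>"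
  shows "expansions M q (seq_value q c) \<approx> (UNIV :: nat set)"
proof -
  obtain p where p: "\<alpha> p < M" "tail_seq (Suc p) \<alpha> = \<alpha>"
    using assms(1) alpha_digits alpha_tail alpha_mirror unfolding U_seqs_iff lex_le_def by blast
  let ?K = "{k. c k < M \<and> tail_seq (Suc k) c = \<alpha>}"
  have step: "Suc k + p \<in> ?K" if "k \<in> ?K" for k
  proof -
    have t: "tail_seq (Suc k) c = \<alpha>" using that by simp
    have "c (Suc k + p) = \<alpha> p" unfolding t[symmetric] by (simp add: tail_seq_def)
    moreover have "tail_seq (Suc (Suc k + p)) c = tail_seq (Suc p) \<alpha>"
      unfolding t[symmetric] by (simp add: tail_seq_tail_seq)
    ultimately show ?thesis using p by simp
  qed
  have "\<exists>n\<in>?K. m \<le> n" for m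
  proof (induction m)
    case 0
    show ?case using c(2,3) by blast
  next
    case (Suc m)
    then obtain n where "n \<in> ?K" "m \<le> n" by blast
    then show ?case using step[of n] by (intro bexI[of _ "Suc n + p"]) simp_all
  qed
  then have "infinite ?K" unfolding infinite_nat_iff_unbounded_le by blast
  then have "infinite ((\<lambda>k. append_seq (Suc k) (c(k := Suc (c k))) (\<lambda>_. 0)) ` ?K)"
    using finite_imageD[OF _ inj_on_subset[OF inj_bumped subset_UNIV]] by blast
  then show ?thesis
    unfolding expansions_eq[OF c]
    by (intro countable_infinite_eqpoll_nat) auto
qed

end

section \<open>Bases in the closure of the univoque bases\<close>

text \<open>Uniqueness makes the relevant tails of \<open>c\<close> and of its reflection worth less
  than 1. The bound for \<open>c\<close> also lets \<open>c\<close> be the upper sequence in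
  \<open>lex_less_of_value_less\<close>, which converts values into the lexicographic order.\<close>

lemma univoque_expansion_lex:
  assumes "q \<in> univoque_bases M"
  obtains c where "c \<in> digit_seqs M" "q > 1" "seq_value q c = 1"
    "\<And>n. c n < M \<Longrightarrow> tail_seq (Suc n) c \<sqsubset> c"
    "\<And>n. 0 < c n \<Longrightarrow> mirror M (tail_seq (Suc n) c) \<sqsubset> c"
proof -
  have q: "q > 1" and ex1: "\<exists>!c. c \<in> digit_seqs M \<and> seq_value q c = 1"
    using assms expansions_iff[of q] unfolding univoque_bases_def by auto
  from ex1 obtain c where c: "c \<in> digit_seqs M" "seq_value q c = 1"
    and uniq1: "\<And>d. d \<in> digit_seqs M \<Longrightarrow> seq_value q d = 1 \<Longrightarrow> d = c" by blast
  have uniq: "d = c" if "d \<in> digit_seqs M" "seq_value q d = seq_value q c" for d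
    by (rule uniq1[OF that(1)]) (use that(2) c(2) in simp)
  have qM: "q \<le> real M + 1" using seq_value_le[OF q c(1)] c(2) q by (simp add: field_simps)
  have tail: "seq_value q (tail_seq (Suc n) c) < 1" if "c n < M" for n
    by (rule unique_expansion_tail_less_one[OF q qM c(1) uniq that])
  have tail': "seq_value q (tail_seq (Suc n) (mirror M c)) < 1" if "mirror M c n < M" for n
    by (rule unique_expansion_tail_less_one[OF q qM mirror_in_digit_seqs unique_mirror[OF q c(1) uniq] that])
  have lex: "e \<sqsubset> c" if "e \<in> digit_seqs M" "seq_value q e < 1" for e
    by (rule lex_less_of_value_less[OF q c(1) that(1)]) (use that c tail less_imp_le in auto)
  show thesis
  proof (rule that[OF c(1) q c(2)])
    show "tail_seq (Suc n) c \<sqsubset> c" if "c n < M" for n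
      by (rule lex[OF tail_seq_in_digit_seqs[OF c(1)] tail[OF that]])
    show "mirror M (tail_seq (Suc n) c) \<sqsubset> c" if "0 < c n" for n
    proof -
      have "c n \<le> M" using c(1) by (simp add: digit_seqs_iff)
      then have "mirror M c n < M" using that by (simp add: mirror_def)
      then show ?thesis using lex[OF mirror_in_digit_seqs] tail'[of n] by (simp add: tail_seq_mirror)
    qed
  qed
qed

text \<open>With a leading 0 any digit after a 0 is bounded by \<open>c 0\<close>, so zeros
  propagate through the whole sequence.\<close>

lemma self_admissible_head_pos:
  assumes "1 \<le> M" "\<And>n. c n < M \<Longrightarrow> tail_seq (Suc n) c \<sqsubset> c" "c i \<noteq> 0"
  shows "0 < c 0"
proof (rule ccontr)
  assume 0: "\<not> ?thesis"
  have "c n = 0" for n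
  proof (induction n)
    case (Suc n)
    then have "\<not> c \<sqsubset> tail_seq (Suc n) c"
      using assms(1) assms(2)[of n] lex_trans lex_irrefl by (metis less_le_trans zero_less_one)
    then have "\<not> c 0 < tail_seq (Suc n) c 0" unfolding lex_less_def by blast
    then show ?case using 0 by (simp add: tail_seq_def)
  qed (use 0 in simp)
  then show False using assms(3) by simp
qed

text \<open>This excludes equality in the limit of the strict lexicographic conditions: if \<open>g\<close> first drops
  below \<open>c\<close>, the condition at position \<open>n\<close> fails, and if it first exceeds \<open>c\<close>, the condition
  after one full period fails.\<close>

lemma antiperiodic_isolated:
  assumes D: "c \<in> digit_seqs M" "g \<in> digit_seqs M"
    and c: "0 < c n" "mirror M (tail_seq (Suc n) c) = c"
    and g: "\<And>n. g n < M \<Longrightarrow> tail_seq (Suc n) g \<sqsubset> g" "\<And>n. 0 < g n \<Longrightarrow> mirror M (tail_seq (Suc n) g) \<sqsubset> g"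
    and close: "\<forall>i < Suc n + Suc n. g i = c i"
  shows False
proof -
  have dig: "c i \<le> M" "g i \<le> M" for i using D by (auto simp: digit_seqs_iff)
  have per: "c (Suc n + x) = M - c x" for x
    using fun_cong[OF c(2), of x] dig(1)[of "Suc n + x"] by (simp add: mirror_def tail_seq_def)
  have gn: "0 < g n" using close c(1) by simp
  have "g \<noteq> c" using g(2)[OF gn] c(2) lex_irrefl by metis
  then obtain i where i: "\<forall>j<i. g j = c j" "g i \<noteq> c i" by (rule first_difference)
  have "Suc n + Suc n \<le> i" using close i(2) by (meson leI)
  then obtain y where y: "i = Suc n + Suc n + y" by (metis le_Suc_ex)
  show False
  proof (cases "g i < c i")
    case True
    have "g \<sqsubset> mirror M (tail_seq (Suc n) g)"
      unfolding lex_less_def mirror_def tail_seq_def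
    proof (intro exI[of _ "Suc n + y"] conjI allI impI)
      have "g (Suc n + y) = c (Suc n + y)" using i(1) y by simp
      also have "\<dots> = M - c i" using per[of "Suc n + y"] y dig(1)[of "Suc n + y"] by (simp add: add.assoc)
      also have "\<dots> < M - g i" using True dig(1)[of i] by simp
      finally show "g (Suc n + y) < M - g (Suc n + (Suc n + y))" using y by (simp add: add.assoc)
      fix z assume "z < Suc n + y"
      then have "g z = c z" "g (Suc n + z) = c (Suc n + z)" using i(1) y by auto
      then show "g z = M - g (Suc n + z)" using per[of z] dig(1)[of z] by simp
    qed
    then show False using g(2)[OF gn] lex_trans lex_irrefl by blast
  next
    case False
    \<comment> \<open>Reflecting twice shows that \<open>c\<close> has period
      \<open>Suc n + Suc n\<close>.\<close>
    have per2: "c (Suc (n + Suc n) + z) = c z" for z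
      using per[of "Suc n + z"] per[of z] dig(1)[of z] by (simp add: add.assoc)
    \<comment> \<open>Index \<open>n + Suc n\<close> is the last one of a period, and its digit
      \<open>M - c n\<close> is below \<open>M\<close>, so the direct condition applies to the tail
      that starts the next period.\<close>
    have "g (n + Suc n) = c (n + Suc n)" using close by simp
    also have "\<dots> < M" using per[of n] c(1) dig(1)[of n] by (simp add: add.commute)
    finally have gl: "g (n + Suc n) < M" .
    have "g \<sqsubset> tail_seq (Suc (n + Suc n)) g"
      unfolding lex_less_def tail_seq_def
    proof (intro exI[of _ y] conjI allI impI)
      have iy: "i = Suc (n + Suc n) + y" using y by simp
      have "g y = c y" using i(1) y by simp
      also have "\<dots> = c i" using per2[of y] iy by simp
      also have "\<dots> < g i" using False i(2) by simp
      finally show "g y < g (Suc (n + Suc n) + y)" using iy by simp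
      fix z assume "z < y"
      then have "g z = c z" "g (Suc (n + Suc n) + z) = c (Suc (n + Suc n) + z)" using i(1) y by auto
      then show "g z = g (Suc (n + Suc n) + z)" using per2[of z] by simp
    qed
    then show False using g(1)[OF gl] lex_trans lex_irrefl by blast
  qed
qed

text \<open>A limit of unique expansions of 1 is used. Its inequalities are weak at first;
  \<open>antiperiodic_isolated\<close> restores strictness for the reflected tails. That the limit
  base exceeds 1 needs a separate argument.\<close>

lemma closure_univoque_bases:
  assumes M: "1 \<le> M" and q: "q \<in> closure (univoque_bases M)"
  obtains \<alpha> where "univoque_closure_base M q \<alpha>"
proof -
  obtain p where p: "\<And>k. p k \<in> univoque_bases M" "p \<longlonglongrightarrow> q"
    using q unfolding closure_sequential by blast
  have "\<forall>k. \<exists>c. c \<in> digit_seqs M \<and> p k > 1 \<and> seq_value (p k) c = 1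
    \<and> (\<forall>n. c n < M \<longrightarrow> tail_seq (Suc n) c \<sqsubset> c) \<and> (\<forall>n. 0 < c n \<longrightarrow> mirror M (tail_seq (Suc n) c) \<sqsubset> c)"
  proof
    fix k
    show "\<exists>c. c \<in> digit_seqs M \<and> p k > 1 \<and> seq_value (p k) c = 1
    \<and> (\<forall>n. c n < M \<longrightarrow> tail_seq (Suc n) c \<sqsubset> c) \<and> (\<forall>n. 0 < c n \<longrightarrow> mirror M (tail_seq (Suc n) c) \<sqsubset> c)"
      by (rule univoque_expansion_lex[OF p(1)[of k]]) blast
  qed
  then obtain f where f: "\<And>k. f k \<in> digit_seqs M" "\<And>k. p k > 1" "\<And>k. seq_value (p k) (f k) = 1"
    "\<And>k n. f k n < M \<Longrightarrow> tail_seq (Suc n) (f k) \<sqsubset> f k"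
    "\<And>k n. 0 < f k n \<Longrightarrow> mirror M (tail_seq (Suc n) (f k)) \<sqsubset> f k"
    by (auto dest!: choice)
  obtain c r where c: "c \<in> digit_seqs M" "strict_mono r"
    "\<And>i. \<forall>\<^sub>F k in sequentially. f (r k) i = c i"
    using digit_seqs_convergent_subsequence[of f M] f(1) by blast
  have pr: "(\<lambda>k. p (r k)) \<longlonglongrightarrow> q"
    using LIMSEQ_subseq_LIMSEQ[OF p(2) c(2)] by (simp add: comp_def)
  have near: "\<exists>k. \<forall>i<N. f (r k) i = c i" for N
    using eventually_prefix_eq[of "\<lambda>k. f (r k)" c N, OF c(3)] by (auto simp: eventually_sequentially)
  have lim_tail: "\<forall>\<^sub>F k in sequentially. tail_seq n (f (r k)) i = tail_seq n c i" for n i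
    using c(3)[of "n + i"] by (simp add: tail_seq_def)
  have lim_mirror: "\<forall>\<^sub>F k in sequentially. mirror M (tail_seq n (f (r k))) i = mirror M (tail_seq n c) i" for n i
    using lim_tail[of n i] by eventually_elim (simp add: mirror_def)
  have tail: "tail_seq (Suc n) c \<sqsubseteq> c" if n: "c n < M" for n
  proof (rule lex_le_limit[OF lim_tail c(3)])
    show "\<forall>\<^sub>F k in sequentially. tail_seq (Suc n) (f (r k)) \<sqsubseteq> f (r k)"
      using c(3)[of n] by eventually_elim (use f(4) n lex_less_imp_le in auto)
  qed
  have mir_le: "mirror M (tail_seq (Suc n) c) \<sqsubseteq> c" if n: "0 < c n" for n
  proof (rule lex_le_limit[OF lim_mirror c(3)])
    show "\<forall>\<^sub>F k in sequentially. mirror M (tail_seq (Suc n) (f (r k))) \<sqsubseteq> f (r k)"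
      using c(3)[of n] by eventually_elim (use f(5) n lex_less_imp_le in auto)
  qed
  have mir: "mirror M (tail_seq (Suc n) c) \<sqsubset> c" if n: "0 < c n" for n
  proof -
    \<comment> \<open>Agreement over two blocks is what \<open>antiperiodic_isolated\<close> needs
      to exclude equality.\<close>
    obtain k where "\<forall>i<Suc n + Suc n. f (r k) i = c i" using near by blast
    then have "mirror M (tail_seq (Suc n) c) \<noteq> c"
      using antiperiodic_isolated[OF c(1) f(1)[of "r k"] n _ f(4) f(5)] by blast
    then show ?thesis using mir_le[OF n] lex_le_def by auto
  qed
  have c0: "0 < c 0"
  proof -
    obtain k where k: "f (r k) 0 = c 0" using near[of 1] by auto
    have "f (r k) \<noteq> (\<lambda>_. 0)" using f(3)[of "r k"] by (auto simp: seq_value_def)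
    then obtain i where "f (r k) i \<noteq> 0" by auto
    then show ?thesis using self_admissible_head_pos[OF M f(4)] k by metis
  qed
  have inf: "\<exists>i\<ge>n. 0 < c i" for n
  proof (rule ccontr)
    assume "\<not> ?thesis"
    then have "\<not> infinite_seq c" using c0 by (auto simp: infinite_seq_iff)
    then obtain k where k: "c k \<noteq> 0" "\<forall>i>k. c i = 0" unfolding infinite_seq_def finite_seq_def by blast
    have "mirror M (tail_seq (Suc k) c) = (\<lambda>_. M)" using k(2) by (auto simp: mirror_def tail_seq_def)
    then show False
      using mir[of k] k(1) lex_le_const_max[OF c(1)] lex_not_less by auto
  qed
  have "q > 1"
  proof (rule ccontr)
    assume "\<not> ?thesis"
    moreover have "q \<ge> 1"
      by (rule LIMSEQ_le_const[OF p(2)]) (use f(2) less_imp_le in blast)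
    ultimately have q1: "q = 1" by simp
    \<comment> \<open>Besides \<open>c 0\<close> there is a second positive digit. In base 1 these
      two already sum to at least 2, while partial sums of expansions of 1 stay at most 1 in the
      limit.\<close>
    obtain i where i: "i \<ge> Suc 0" "0 < c i" using inf by blast
    have "(\<lambda>k. \<Sum>j<Suc i. real (c j) / p (r k) ^ Suc j) \<longlonglongrightarrow> (\<Sum>j<Suc i. real (c j) / q ^ Suc j)"
      using pr q1 by (intro tendsto_intros) auto
    moreover have "\<forall>\<^sub>F k in sequentially. (\<Sum>j<Suc i. real (c j) / p (r k) ^ Suc j) \<le> 1"
      using eventually_prefix_eq[of "\<lambda>k. f (r k)" c "Suc i", OF c(3)]
    proof eventually_elim
      case (elim k)
      have "(\<Sum>j<Suc i. real (c j) / p (r k) ^ Suc j) = (\<Sum>j<Suc i. real (f (r k) j) / p (r k) ^ Suc j)"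
        using elim by (intro sum.cong) auto
      also have "\<dots> \<le> seq_value (p (r k)) (f (r k))"
        unfolding seq_value_def using summable_digits[OF f(2) f(1), of "r k" "r k"] f(2)[of "r k"]
        by (intro sum_le_suminf) auto
      finally show ?case using f(3) by simp
    qed
    ultimately have "(\<Sum>j<Suc i. real (c j) / q ^ Suc j) \<le> 1"
      by (rule tendsto_upperbound) simp
    then have "(\<Sum>j<Suc i. c j) \<le> 1" using q1 by (simp flip: of_nat_sum of_nat_Suc)
    moreover have "(\<Sum>j\<in>{0, i}. c j) \<le> (\<Sum>j<Suc i. c j)" by (rule sum_mono2) auto
    moreover have "(\<Sum>j\<in>{0, i}. c j) = c 0 + c i" using i(1) by simp
    ultimately show False using c0 i(2) by linarith
  qed
  have "(\<lambda>k. seq_value (p (r k)) (f (r k))) \<longlonglongrightarrow> seq_value q c"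
    by (rule seq_value_tendsto[OF pr \<open>q > 1\<close>, of "\<lambda>k. f (r k)" M]) (use f(1) c(3) in auto)
  then have "seq_value q c = 1" using f(3) by (simp add: LIMSEQ_const_iff)
  then have "univoque_closure_base M q c"
    using M \<open>q > 1\<close> c(1) tail mir by unfold_locales
  then show thesis by (rule that)
qed

theorem theorem1p1:
  fixes M :: nat and q :: real
  assumes "M \<ge> 1" and "q \<in> closure (univoque_bases M)"
  shows "closure (U_set M q) = V_set M q
    \<and> (V_set M q - U_set M q \<approx> (UNIV :: nat set)
        \<and> V_set M q \<subseteq> closure (V_set M q - U_set M q))
    \<and> (q \<in> univoque_bases M \<longrightarrow>
        (\<forall>x \<in> V_set M q - U_set M q. card (expansions M q x) = 2))
    \<and> (q \<in> closure (univoque_bases M) - univoque_bases M \<longrightarrow>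
        (\<forall>x \<in> V_set M q - U_set M q. expansions M q x \<approx> (UNIV :: nat set)))"
proof -
  obtain \<alpha> where "univoque_closure_base M q \<alpha>" using closure_univoque_bases[OF assms] .
  then interpret univoque_closure_base M q \<alpha> .
  \<comment> \<open>Reflection preserves the number of expansions and reduces the second case of
    \<open>V_minus_U_cases\<close> to the first.\<close>
  have mirror_bij: "bij_betw (mirror M) (expansions M q (seq_value q (mirror M c))) (expansions M q (seq_value q c))"
    if "c \<in> V_seqs" for c
    using expansions_mirror[OF q_gt_1] that by (simp add: V_seqs_def)
  have "card (expansions M q x) = 2" if "q \<in> univoque_bases M" and x: "x \<in> V_set M q - U_set M q" for x
  proof -
    have "\<alpha> \<in> U_seqs" using that(1) univoque_base_iff by blast
    from x show ?thesis
    proof (cases rule: V_minus_U_cases)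
      case (1 c k)
      then show ?thesis using two_expansions[OF \<open>\<alpha> \<in> U_seqs\<close>] by simp
    next
      case (2 c k)
      then show ?thesis
        using two_expansions[OF \<open>\<alpha> \<in> U_seqs\<close> 2(1-3)] bij_betw_same_card[OF mirror_bij[OF 2(1)]] by simp
    qed
  qed
  moreover have "expansions M q x \<approx> (UNIV :: nat set)"
    if "q \<notin> univoque_bases M" and x: "x \<in> V_set M q - U_set M q" for x
  proof -
    have "\<alpha> \<notin> U_seqs" using that(1) univoque_base_iff by blast
    from x show ?thesis
    proof (cases rule: V_minus_U_cases)
      case (1 c k)
      then show ?thesis using countably_many_expansions[OF \<open>\<alpha> \<notin> U_seqs\<close>] by simp
    next
      case (2 c k)
      have "expansions M q x \<approx> expansions M q (seq_value q c)"
        using mirror_bij[OF 2(1)] 2(4) unfolding eqpoll_def by blast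
      then show ?thesis
        using countably_many_expansions[OF \<open>\<alpha> \<notin> U_seqs\<close> 2(1-3)] eqpoll_trans by blast
    qed
  qed
  ultimately show ?thesis
    using closure_U_set V_minus_U_dense
      countable_infinite_eqpoll_nat[OF countable_V_minus_U infinite_V_minus_U] by blast
qed

end
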